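(* The category $\mathsf{StKFrm}$ of stably compact frames and proper frame homomorphisms is dually equivalent to the category $\mathsf{StKLPries}$ of StKL-spaces and proper L-morphisms.
   Context: A frame is a complete lattice $L$ satisfying $a\wedge\bigvee S=\bigvee\{a\wedge s\mid s\in S\}$ for all $a\in L$, $S\subseteq L$. A frame homomorphism is a map between frames preserving finite meets and arbitrary joins. For $a,b\in L$, $a\ll b$ (way below) means: for each $S\subseteq L$ with $b\le\bigvee S$ there is a finite $T\subseteq S$ with $a\le\bigvee T$. $L$ is compact if $1\ll 1$; $L$ is continuous if $a=\bigvee\{b\in L\mid b\ll a\}$ for all $a\in L$; $\ll$ is stable if $a\ll b$ and $a\ll c$ imply $a\ll b\wedge c$. $L$ is stably continuous if it is continuous and $\ll$ is stable, and stably compact if it is compact and stably continuous. A frame homomorphism $h$ is proper if $a\ll b$ implies $h(a)\ll h(b)$. $\mathsf{StKFrm}$ is the category of stably compact frames and proper frame homomorphisms. For a poset, $\mathord\uparrow S$ and $\mathord\downarrow S$ denote the up-closure and down-closure of a subset $S$; $\mathord\downarrow x=\mathord\downarrow\{x\}$; $S$ is an upset if $S=\mathord\uparrow S$; $\min(S)$ is the set of minimal elements of $S$. $\mathrm{cl}$ is topological closure. A Priestley space is a compact topological space $X$ with a partial order $\le$ such that whenever $x\not\le y$ there is a clopen upset $U$ with $x\in U$, $y\notin U$. $\mathrm{ClopUp}(X)$ is the set of clopen upsets of $X$. An Esakia space is a Priestley space in which $\mathord\downarrow U$ is clopen for every clopen $U$. An L-space is an Esakia space in which $\mathrm{cl}\,U$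 is open for every open upset $U$. An L-morphism $f:X_1\to X_2$ between L-spaces is a continuous order-preserving map such that $f^{-1}(\mathrm{cl}\,U)=\mathrm{cl}\,f^{-1}(U)$ for every open upset $U$ of $X_2$. Let $X$ be an L-space. For $U,V\in\mathrm{ClopUp}(X)$, $V\ll U$ means: for each open upset $W$ of $X$, $U\subseteq\mathrm{cl}\,W$ implies $V\subseteq W$. The kernel of $U\in\mathrm{ClopUp}(X)$ is $\ker U=\bigcup\{V\in\mathrm{ClopUp}(X)\mid V\ll U\}$. $X$ is a CL-space if $\ker U$ is dense in $U$ for every $U\in\mathrm{ClopUp}(X)$. An L-morphism $f:X_1\to X_2$ is proper if $f^{-1}(\ker U)\subseteq\ker f^{-1}(U)$ for all $U\in\mathrm{ClopUp}(X_2)$. The localic part of $X$ is $Y=\{y\in X\mid\mathord\downarrow y\text{ is clopen}\}$. A Scott upset of $X$ is a closed upset $F$ with $\min(F)\subseteq Y$. $X$ is Scott-stable if $F\cap G$ is a Scott upset for all Scott upsets $F,G$ of $X$. A StCL-space is a Scott-stable CL-space. $X$ is L-compact if $X$ itself is a Scott upset (i.e. $\min(X)\subseteq Y$). A StKL-space (stably L-compact L-space) is an L-compact StCL-space. $\mathsf{StKLPries}$ is the category of StKL-spaces and proper L-morphisms. *)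

theory Defs
  imports
    "HOL-Algebra.Complete_Lattice"
    "HOL-Analysis.Abstract_Topology"
    "HOL-Library.Equipollence"
    "HOL-Library.FuncSet"
begin

section \<open>Categories and dual equivalence\<close>

record ('o, 'm) category =
  Obj :: "'o set"
  Arr :: "'m set"
  Dom :: "'m \<Rightarrow> 'o"
  Cod :: "'m \<Rightarrow> 'o"
  Ident :: "'o \<Rightarrow> 'm"
  Comp :: "'m \<Rightarrow> 'm \<Rightarrow> 'm"  \<comment> \<open>\<open>Comp C g f\<close> is \<open>g\<close> after \<open>f\<close>\<close>

definition arrows :: "('o, 'm) category \<Rightarrow> 'o \<Rightarrow> 'o \<Rightarrow> 'm set" where
  "arrows C A B = {f \<in> Arr C. Dom C f = A \<and> Cod C f = B}"

definition is_category :: "('o, 'm) category \<Rightarrow> bool" where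
  "is_category C \<longleftrightarrow>
     (\<forall>f \<in> Arr C. Dom C f \<in> Obj C \<and> Cod C f \<in> Obj C) \<and>
     (\<forall>A \<in> Obj C. Ident C A \<in> arrows C A A) \<and>
     (\<forall>f \<in> Arr C. \<forall>g \<in> Arr C. Cod C f = Dom C g \<longrightarrow>
        Comp C g f \<in> arrows C (Dom C f) (Cod C g)) \<and>
     (\<forall>f \<in> Arr C. Comp C f (Ident C (Dom C f)) = f \<and> Comp C (Ident C (Cod C f)) f = f) \<and>
     (\<forall>f \<in> Arr C. \<forall>g \<in> Arr C. \<forall>h \<in> Arr C. Cod C f = Dom C g \<and> Cod C g = Dom C h \<longrightarrow>
        Comp C h (Comp C g f) = Comp C (Comp C h g) f)"

definition op_category :: "('o, 'm) category \<Rightarrow> ('o, 'm) category" where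
  "op_category C = \<lparr>Obj = Obj C, Arr = Arr C, Dom = Cod C, Cod = Dom C, Ident = Ident C,
     Comp = (\<lambda>g f. Comp C f g)\<rparr>"

record ('o, 'm, 'p, 'n) functor_maps =
  obj_map :: "'o \<Rightarrow> 'p"
  arr_map :: "'m \<Rightarrow> 'n"

definition is_functor ::
  "('o, 'm) category \<Rightarrow> ('p, 'n) category \<Rightarrow> ('o, 'm, 'p, 'n) functor_maps \<Rightarrow> bool" where
  "is_functor C D F \<longleftrightarrow>
     (\<forall>A \<in> Obj C. obj_map F A \<in> Obj D) \<and>
     (\<forall>f \<in> Arr C. arr_map F f \<in> arrows D (obj_map F (Dom C f)) (obj_map F (Cod C f))) \<and>
     (\<forall>A \<in> Obj C. arr_map F (Ident C A) = Ident D (obj_map F A)) \<and>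
     (\<forall>f \<in> Arr C. \<forall>g \<in> Arr C. Cod C f = Dom C g \<longrightarrow>
        arr_map F (Comp C g f) = Comp D (arr_map F g) (arr_map F f))"

definition id_functor :: "('o, 'm, 'o, 'm) functor_maps" where
  "id_functor = \<lparr>obj_map = (\<lambda>A. A), arr_map = (\<lambda>f. f)\<rparr>"

definition comp_functor ::
  "('p, 'n, 'q, 'k) functor_maps \<Rightarrow> ('o, 'm, 'p, 'n) functor_maps \<Rightarrow> ('o, 'm, 'q, 'k) functor_maps" where
  "comp_functor G F = \<lparr>obj_map = obj_map G \<circ> obj_map F, arr_map = arr_map G \<circ> arr_map F\<rparr>"

definition is_iso :: "('o, 'm) category \<Rightarrow> 'm \<Rightarrow> bool" where
  "is_iso C f \<longleftrightarrow> f \<in> Arr C \<and>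
     (\<exists>g \<in> arrows C (Cod C f) (Dom C f).
        Comp C g f = Ident C (Dom C f) \<and> Comp C f g = Ident C (Cod C f))"

definition natural_iso ::
  "('o, 'm) category \<Rightarrow> ('p, 'n) category \<Rightarrow> ('o, 'm, 'p, 'n) functor_maps \<Rightarrow>
    ('o, 'm, 'p, 'n) functor_maps \<Rightarrow> ('o \<Rightarrow> 'n) \<Rightarrow> bool" where
  "natural_iso C D F G \<tau> \<longleftrightarrow>
     (\<forall>A \<in> Obj C. \<tau> A \<in> arrows D (obj_map F A) (obj_map G A) \<and> is_iso D (\<tau> A)) \<and>
     (\<forall>f \<in> Arr C. Comp D (\<tau> (Cod C f)) (arr_map F f) = Comp D (arr_map G f) (\<tau> (Dom C f)))"

definition equivalent_categories :: "('o, 'm) category \<Rightarrow> ('p, 'n) category \<Rightarrow> bool" where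
  "equivalent_categories C D \<longleftrightarrow> is_category C \<and> is_category D \<and>
     (\<exists>F G. is_functor C D F \<and> is_functor D C G \<and>
        (\<exists>\<eta>. natural_iso C C id_functor (comp_functor G F) \<eta>) \<and>
        (\<exists>\<epsilon>. natural_iso D D (comp_functor F G) id_functor \<epsilon>))"

definition dually_equivalent :: "('o, 'm) category \<Rightarrow> ('p, 'n) category \<Rightarrow> bool" where
  "dually_equivalent C D \<longleftrightarrow> equivalent_categories C (op_category D)"

text \<open>
  The category of structured sets with object class \<open>Os\<close>, underlying sets \<open>S\<close>, and as arrows
  \<open>A \<rightarrow> B\<close> the maps satisfying \<open>M A B\<close>, composed as functions. Arrows carry their domain and
  codomain, and the maps are extensional: every map on \<open>S A\<close> is represented by exactly one HOL
  function.
\<close>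
definition concrete_category ::
  "'o set \<Rightarrow> ('o \<Rightarrow> 'a set) \<Rightarrow> ('o \<Rightarrow> 'o \<Rightarrow> ('a \<Rightarrow> 'a) \<Rightarrow> bool) \<Rightarrow> ('o, 'o \<times> ('a \<Rightarrow> 'a) \<times> 'o) category"
where
  "concrete_category Os S M =
    \<lparr>Obj = Os,
     Arr = {(A, f, B). A \<in> Os \<and> B \<in> Os \<and> f \<in> extensional (S A) \<and> M A B f},
     Dom = (\<lambda>(A, f, B). A),
     Cod = (\<lambda>(A, f, B). B),
     Ident = (\<lambda>A. (A, restrict id (S A), A)),
     Comp = (\<lambda>(B', g, C) (A, f, B). (A, compose (S A) g f, C))\<rparr>"


section \<open>Stably compact frames\<close>

definition is_frame :: "'a gorder \<Rightarrow> bool" where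
  "is_frame L \<longleftrightarrow> complete_lattice L \<and>
     (\<forall>a \<in> carrier L. \<forall>S \<subseteq> carrier L.
        a \<sqinter>\<^bsub>L\<^esub> (\<Squnion>\<^bsub>L\<^esub>S) = \<Squnion>\<^bsub>L\<^esub>((\<lambda>s. a \<sqinter>\<^bsub>L\<^esub> s) ` S))"

definition frame_hom :: "'a gorder \<Rightarrow> 'b gorder \<Rightarrow> ('a \<Rightarrow> 'b) \<Rightarrow> bool" where
  "frame_hom L M h \<longleftrightarrow> h \<in> carrier L \<rightarrow> carrier M \<and>
     (\<forall>S \<subseteq> carrier L. finite S \<longrightarrow> h (\<Sqinter>\<^bsub>L\<^esub>S) = \<Sqinter>\<^bsub>M\<^esub>(h ` S)) \<and>
     (\<forall>S \<subseteq> carrier L. h (\<Squnion>\<^bsub>L\<^esub>S) = \<Squnion>\<^bsub>M\<^esub>(h ` S))"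

definition way_below :: "'a gorder \<Rightarrow> 'a \<Rightarrow> 'a \<Rightarrow> bool" where
  "way_below L a b \<longleftrightarrow> a \<in> carrier L \<and> b \<in> carrier L \<and>
     (\<forall>S \<subseteq> carrier L. b \<sqsubseteq>\<^bsub>L\<^esub> \<Squnion>\<^bsub>L\<^esub>S \<longrightarrow> (\<exists>T \<subseteq> S. finite T \<and> a \<sqsubseteq>\<^bsub>L\<^esub> \<Squnion>\<^bsub>L\<^esub>T))"

definition compact_frame :: "'a gorder \<Rightarrow> bool" where
  "compact_frame L \<longleftrightarrow> is_frame L \<and> way_below L \<top>\<^bsub>L\<^esub> \<top>\<^bsub>L\<^esub>"

definition continuous_frame :: "'a gorder \<Rightarrow> bool" where
  "continuous_frame L \<longleftrightarrow> is_frame L \<and>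
     (\<forall>a \<in> carrier L. a = \<Squnion>\<^bsub>L\<^esub>{b \<in> carrier L. way_below L b a})"

definition way_below_stable :: "'a gorder \<Rightarrow> bool" where
  "way_below_stable L \<longleftrightarrow>
     (\<forall>a \<in> carrier L. \<forall>b \<in> carrier L. \<forall>c \<in> carrier L.
        way_below L a b \<and> way_below L a c \<longrightarrow> way_below L a (b \<sqinter>\<^bsub>L\<^esub> c))"

definition stably_continuous_frame :: "'a gorder \<Rightarrow> bool" where
  "stably_continuous_frame L \<longleftrightarrow> continuous_frame L \<and> way_below_stable L"

definition stably_compact_frame :: "'a gorder \<Rightarrow> bool" where
  "stably_compact_frame L \<longleftrightarrow> compact_frame L \<and> stably_continuous_frame L"

definition proper_frame_hom :: "'a gorder \<Rightarrow> 'b gorder \<Rightarrow> ('a \<Rightarrow> 'b) \<Rightarrow> bool" where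
  "proper_frame_hom L M h \<longleftrightarrow> frame_hom L M h \<and>
     (\<forall>a \<in> carrier L. \<forall>b \<in> carrier L. way_below L a b \<longrightarrow> way_below M (h a) (h b))"


section \<open>Priestley spaces, Esakia spaces and L-spaces\<close>

record 'a ordered_space =
  topo :: "'a topology"
  ord :: "'a rel"

abbreviation points :: "'a ordered_space \<Rightarrow> 'a set" where
  "points X \<equiv> topspace (topo X)"

abbreviation cl :: "'a ordered_space \<Rightarrow> 'a set \<Rightarrow> 'a set" where
  "cl X S \<equiv> topo X closure_of S"

definition up :: "'a ordered_space \<Rightarrow> 'a set \<Rightarrow> 'a set" where
  "up X S = {y \<in> points X. \<exists>x \<in> S. (x, y) \<in> ord X}"

definition down :: "'a ordered_space \<Rightarrow> 'a set \<Rightarrow> 'a set" where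
  "down X S = {y \<in> points X. \<exists>x \<in> S. (y, x) \<in> ord X}"

definition minimal :: "'a ordered_space \<Rightarrow> 'a set \<Rightarrow> 'a set" where
  "minimal X S = {x \<in> S. \<forall>y \<in> S. (y, x) \<in> ord X \<longrightarrow> y = x}"

definition upset :: "'a ordered_space \<Rightarrow> 'a set \<Rightarrow> bool" where
  "upset X S \<longleftrightarrow> S \<subseteq> points X \<and> S = up X S"

definition clopen :: "'a ordered_space \<Rightarrow> 'a set \<Rightarrow> bool" where
  "clopen X U \<longleftrightarrow> openin (topo X) U \<and> closedin (topo X) U"

definition open_upset :: "'a ordered_space \<Rightarrow> 'a set \<Rightarrow> bool" where
  "open_upset X U \<longleftrightarrow> openin (topo X) U \<and> upset X U"

definition ClopUp :: "'a ordered_space \<Rightarrow> 'a set set" where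
  "ClopUp X = {U. clopen X U \<and> upset X U}"

definition priestley_space :: "'a ordered_space \<Rightarrow> bool" where
  "priestley_space X \<longleftrightarrow> compact_space (topo X) \<and> partial_order_on (points X) (ord X) \<and>
     (\<forall>x \<in> points X. \<forall>y \<in> points X. (x, y) \<notin> ord X \<longrightarrow> (\<exists>U \<in> ClopUp X. x \<in> U \<and> y \<notin> U))"

definition esakia_space :: "'a ordered_space \<Rightarrow> bool" where
  "esakia_space X \<longleftrightarrow> priestley_space X \<and> (\<forall>U. clopen X U \<longrightarrow> clopen X (down X U))"

definition L_space :: "'a ordered_space \<Rightarrow> bool" where
  "L_space X \<longleftrightarrow> esakia_space X \<and> (\<forall>U. open_upset X U \<longrightarrow> openin (topo X) (cl X U))"

definition preimage :: "'a ordered_space \<Rightarrow> ('a \<Rightarrow> 'b) \<Rightarrow> 'b set \<Rightarrow> 'a set" where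
  "preimage X f U = {x \<in> points X. f x \<in> U}"

definition L_morphism :: "'a ordered_space \<Rightarrow> 'b ordered_space \<Rightarrow> ('a \<Rightarrow> 'b) \<Rightarrow> bool" where
  "L_morphism X1 X2 f \<longleftrightarrow> continuous_map (topo X1) (topo X2) f \<and>
     (\<forall>x y. (x, y) \<in> ord X1 \<longrightarrow> (f x, f y) \<in> ord X2) \<and>
     (\<forall>U. open_upset X2 U \<longrightarrow> preimage X1 f (cl X2 U) = cl X1 (preimage X1 f U))"


section \<open>StKL-spaces\<close>

definition space_way_below :: "'a ordered_space \<Rightarrow> 'a set \<Rightarrow> 'a set \<Rightarrow> bool" where
  "space_way_below X V U \<longleftrightarrow> (\<forall>W. open_upset X W \<longrightarrow> U \<subseteq> cl X W \<longrightarrow> V \<subseteq> W)"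

definition ker :: "'a ordered_space \<Rightarrow> 'a set \<Rightarrow> 'a set" where
  "ker X U = \<Union>{V \<in> ClopUp X. space_way_below X V U}"

definition CL_space :: "'a ordered_space \<Rightarrow> bool" where
  "CL_space X \<longleftrightarrow> L_space X \<and>
     (\<forall>U \<in> ClopUp X. subtopology (topo X) U closure_of ker X U = U)"

definition proper_L_morphism :: "'a ordered_space \<Rightarrow> 'b ordered_space \<Rightarrow> ('a \<Rightarrow> 'b) \<Rightarrow> bool" where
  "proper_L_morphism X1 X2 f \<longleftrightarrow> L_morphism X1 X2 f \<and>
     (\<forall>U \<in> ClopUp X2. preimage X1 f (ker X2 U) \<subseteq> ker X1 (preimage X1 f U))"

definition localic_part :: "'a ordered_space \<Rightarrow> 'a set" where
  "localic_part X = {y \<in> points X. clopen X (down X {y})}"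

definition scott_upset :: "'a ordered_space \<Rightarrow> 'a set \<Rightarrow> bool" where
  "scott_upset X F \<longleftrightarrow> closedin (topo X) F \<and> upset X F \<and> minimal X F \<subseteq> localic_part X"

definition scott_stable :: "'a ordered_space \<Rightarrow> bool" where
  "scott_stable X \<longleftrightarrow> (\<forall>F G. scott_upset X F \<and> scott_upset X G \<longrightarrow> scott_upset X (F \<inter> G))"

definition StCL_space :: "'a ordered_space \<Rightarrow> bool" where
  "StCL_space X \<longleftrightarrow> CL_space X \<and> scott_stable X"

definition L_compact :: "'a ordered_space \<Rightarrow> bool" where
  "L_compact X \<longleftrightarrow> scott_upset X (points X)"

definition StKL_space :: "'a ordered_space \<Rightarrow> bool" where
  "StKL_space X \<longleftrightarrow> StCL_space X \<and> L_compact X"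


section \<open>The two categories\<close>

text \<open>
  The categories of all stably compact frames and of all StKL-spaces are large, so a universe is
  needed, and it is a parameter: an arbitrary family \<open>\<U>\<close> of sets over an arbitrary type \<open>'a\<close>.
  Frames are \<open>\<U>\<close>-small if their carrier is in \<open>\<U>\<close>. Spaces are \<open>\<U>\<close>-small if their clopen
  upsets are equinumerous with a member of \<open>\<U>\<close>; their points are drawn from \<open>'a set\<close>.

  Smallness of a space is measured on its clopen upsets because a Priestley space has no more points
  than there are sets of clopen upsets, whereas a frame usually has more prime filters than elements.
  If \<open>\<U>\<close> is closed under equinumerous copies within \<open>'a\<close>, subsets, and (up to equinumerosity) power
  sets, as for the sets below an inaccessible cardinal, then a Priestley space is \<open>\<U>\<close>-small iff
  its set of points is equinumerous with a member of \<open>\<U>\<close>, so that both categories consist of all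
  small objects in the usual sense.
  For \<open>\<U> = UNIV\<close> the first category contains every stably compact frame over \<open>'a\<close>, and the second
  contains, up to isomorphism, every StKL-space (over any type) with at most as many clopen upsets
  as \<open>'a\<close> has elements. As \<open>'a\<close> is arbitrary, every frame and every space is covered.
\<close>

definition StKFrm :: "'a set set \<Rightarrow> ('a gorder, 'a gorder \<times> ('a \<Rightarrow> 'a) \<times> 'a gorder) category" where
  "StKFrm \<U> = concrete_category {L. stably_compact_frame L \<and> carrier L \<in> \<U>} carrier proper_frame_hom"

definition StKLPries :: "'a set set \<Rightarrow>
    ('a set ordered_space, 'a set ordered_space \<times> ('a set \<Rightarrow> 'a set) \<times> 'a set ordered_space) category"
where
  "StKLPries \<U> = concrete_category {X. StKL_space X \<and> (\<exists>A \<in> \<U>. ClopUp X \<approx> A)} points proper_L_morphism"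

end

theory Submission
  imports Defs "HOL-Analysis.Function_Topology"
begin

text \<open>
  The equivalence is Priestley duality, cut down to stably compact frames. The clopen upsets of a
  space \<open>X\<close> form a lattice, and the prime filters of a lattice \<open>L\<close> form a Priestley space whose clopen
  upsets are a copy of \<open>L\<close>. Say that a bijection \<open>\<phi>\<close> from \<open>L\<close> onto the clopen upsets of a Priestley
  space \<open>X\<close> which preserves and reflects order \<^emph>\<open>represents\<close> \<open>L\<close> on \<open>X\<close>. The proof never compares the
  two constructions with each other; it only uses that every frame and every space occurs in some
  representation, and that a representation translates each notion on one side into its namesake on
  the other.

  \<^item> \<^emph>\<open>Objects.\<close> In a represented complete lattice, a join is the closure of the union, so that frames
    are represented exactly on L-spaces (\<open>is_frame_iff\<close>). An open upset \<open>W\<close> is the union of the clopen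
    upsets that it contains; thus \<open>W\<close> stands for a family of elements and \<open>cl W\<close> for its join.
    With compactness of clopen sets this turns the way below relation on \<open>L\<close> into the one on
    \<open>ClopUp X\<close> (\<open>way_below_iff\<close>). A closed upset \<open>F\<close> is a Scott upset iff \<open>F \<subseteq> cl W\<close> implies \<open>F \<subseteq> W\<close> for all
    open upsets \<open>W\<close> (\<open>scott_upset_iff\<close>). For \<open>F = X\<close> this is compactness of \<open>L\<close>. Density of kernels is
    continuity of \<open>L\<close>. Given density, Scott upsets can be interpolated between clopen upsets
    \<open>V \<ll> U\<close>, and each Scott upset inside \<open>U\<close> is inside some \<open>V \<ll> U\<close>; so closure of Scott upsets under
    intersection is stability of \<open>\<ll>\<close> (\<open>scott_stable_iff\<close>).

  \<^item> \<^emph>\<open>Arrows.\<close> For representations \<open>\<phi>\<close> of \<open>L\<close> on \<open>X\<close> and \<open>\<psi>\<close> of \<open>M\<close> on \<open>Y\<close>, the condition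
    that \<open>f\<close> pulls \<open>\<phi> a\<close> back to \<open>\<psi> (h a)\<close> for all \<open>a\<close> sets up a bijection between proper frame
    homomorphisms \<open>h\<close> from \<open>L\<close> to \<open>M\<close> and proper L-morphisms \<open>f\<close> from \<open>Y\<close> to \<open>X\<close> (\<open>proper_dual_map\<close>, \<open>proper_dual_hom\<close>), compatible with
    identities and composition.

  \<^item> \<^emph>\<open>Existence.\<close> A frame is represented on its space of prime filters (\<open>represents_spectrum\<close>), a
    space by any copy of its lattice of clopen upsets (\<open>frame_representation_exists\<close>).

  A purely categorical argument (\<open>correspondence.equivalent\<close>) then produces the two functors and the
  natural isomorphisms by choosing a representation of every object.
\<close>

section \<open>Equivalences of categories from correspondences between arrows\<close>

text \<open>
  Objects \<open>A\<close> and \<open>B\<close> of two categories are linked by witnesses \<open>r\<close>; relative to witnesses for the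
  domains and for the codomains, arrows of the two categories correspond one to one. An object may have
  several witnesses and several partners, so that neither functor of an equivalence has to be described
  in order to exhibit this structure.
\<close>
locale correspondence =
  fixes C :: "('o, 'm) category" and D :: "('p, 'n) category"
    and Rep :: "'o \<Rightarrow> 'r \<Rightarrow> 'p \<Rightarrow> bool"
    and Cor :: "'r \<Rightarrow> 'r \<Rightarrow> 'm \<Rightarrow> 'n \<Rightarrow> bool"
  assumes cat_C: "is_category C" and cat_D: "is_category D"
    and Rep_Obj: "Rep A r B \<Longrightarrow> A \<in> Obj C \<and> B \<in> Obj D"
    and total_C: "A \<in> Obj C \<Longrightarrow> \<exists>r B. Rep A r B"
    and total_D: "B \<in> Obj D \<Longrightarrow> \<exists>r A. Rep A r B"
    and Cor_D: "\<lbrakk>Rep A r B; Rep A' r' B'; h \<in> arrows C A A'\<rbrakk>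
      \<Longrightarrow> \<exists>!f. f \<in> arrows D B B' \<and> Cor r r' h f"
    and Cor_C: "\<lbrakk>Rep A r B; Rep A' r' B'; f \<in> arrows D B B'\<rbrakk>
      \<Longrightarrow> \<exists>!h. h \<in> arrows C A A' \<and> Cor r r' h f"
    and Cor_Ident: "Rep A r B \<Longrightarrow> Cor r r (Ident C A) (Ident D B)"
    and Cor_Comp: "\<lbrakk>Rep A r B; Rep A' r' B'; Rep A'' r'' B'';
        h \<in> arrows C A A'; h' \<in> arrows C A' A''; f \<in> arrows D B B'; f' \<in> arrows D B' B'';
        Cor r r' h f; Cor r' r'' h' f'\<rbrakk>
      \<Longrightarrow> Cor r r'' (Comp C h' h) (Comp D f' f)"
begin

lemma Ident_arrow:
  "A \<in> Obj C \<Longrightarrow> Ident C A \<in> arrows C A A" "B \<in> Obj D \<Longrightarrow> Ident D B \<in> arrows D B B"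
  using cat_C cat_D by (simp_all add: is_category_def)

lemma Comp_arrow:
  "\<lbrakk>h \<in> arrows C A A'; h' \<in> arrows C A' A''\<rbrakk> \<Longrightarrow> Comp C h' h \<in> arrows C A A''"
  "\<lbrakk>f \<in> arrows D B B'; f' \<in> arrows D B' B''\<rbrakk> \<Longrightarrow> Comp D f' f \<in> arrows D B B''"
  using cat_C cat_D by (auto simp add: is_category_def arrows_def)

lemma Comp_Ident:
  "h \<in> arrows C A A' \<Longrightarrow> Comp C h (Ident C A) = h \<and> Comp C (Ident C A') h = h"
  "f \<in> arrows D B B' \<Longrightarrow> Comp D f (Ident D B) = f \<and> Comp D (Ident D B') f = f"
  using cat_C cat_D by (auto simp add: is_category_def arrows_def)

lemma eq_C:
  assumes "Rep A r B" "Rep A' r' B'" "f \<in> arrows D B B'"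
    and "h1 \<in> arrows C A A'" "h2 \<in> arrows C A A'" "Cor r r' h1 f" "Cor r r' h2 f"
  shows "h1 = h2"
  using Cor_C[OF assms(1-3)] assms(4-) by blast

lemma eq_D:
  assumes "Rep A r B" "Rep A' r' B'" "h \<in> arrows C A A'"
    and "f1 \<in> arrows D B B'" "f2 \<in> arrows D B B'" "Cor r r' h f1" "Cor r r' h f2"
  shows "f1 = f2"
  using Cor_D[OF assms(1-3)] assms(4-) by blast

text \<open>
  Two representatives of the same object are isomorphic: the inverse corresponds to the same identity
  arrow read in the other direction, and both composites correspond to an identity.
\<close>
lemma iso_C:
  assumes r: "Rep A r B" and r': "Rep A' r' B"
    and h: "h \<in> arrows C A A'" "Cor r r' h (Ident D B)"
  shows "is_iso C h"
proof -
  have B: "Ident D B \<in> arrows D B B"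
    using Rep_Obj[OF r] Ident_arrow by simp
  obtain g where g: "g \<in> arrows C A' A" "Cor r' r g (Ident D B)"
    using Cor_C[OF r' r B] by blast
  have "Comp C g h = Ident C A"
    using eq_C[OF r r B] Cor_Comp[OF r r' r h(1) g(1) B B h(2) g(2)] Comp_Ident(2)[OF B]
      Cor_Ident[OF r] Rep_Obj[OF r] Ident_arrow Comp_arrow(1)[OF h(1) g(1)] by metis
  moreover have "Comp C h g = Ident C A'"
    using eq_C[OF r' r' B] Cor_Comp[OF r' r r' g(1) h(1) B B g(2) h(2)] Comp_Ident(2)[OF B]
      Cor_Ident[OF r'] Rep_Obj[OF r'] Ident_arrow Comp_arrow(1)[OF g(1) h(1)] by metis
  ultimately show ?thesis
    using g h unfolding is_iso_def arrows_def by auto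
qed

lemma converse_correspondence:
  "correspondence D C (\<lambda>B r A. Rep A r B) (\<lambda>r r' f h. Cor r r' h f)"
  by unfold_locales
    (use cat_C cat_D Rep_Obj total_C total_D Cor_C Cor_D Cor_Ident in \<open>auto intro: Cor_Comp\<close>)

text \<open>
  Fix a partner \<open>F A\<close> in \<open>D\<close> for every \<open>A\<close> and a partner \<open>G B\<close> in \<open>C\<close> for every \<open>B\<close>. The partner of an
  arrow is then determined, and functoriality is uniqueness of partners. The objects \<open>A\<close> and \<open>G (F A)\<close>
  are both linked to \<open>F A\<close>, so the identity of \<open>F A\<close> has a partner \<open>A \<rightarrow> G (F A)\<close>; this is the unit, and the
  counit arises in the same way. Naturality is again uniqueness of partners.
\<close>
theorem equivalent: "equivalent_categories C D"
proof -
  interpret conv: correspondence D C "\<lambda>B r A. Rep A r B" "\<lambda>r r' f h. Cor r r' h f"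
    by (rule converse_correspondence)
  obtain F\<^sub>r F\<^sub>o where F: "Rep A (F\<^sub>r A) (F\<^sub>o A)" if "A \<in> Obj C" for A
    using total_C by metis
  obtain G\<^sub>r G\<^sub>o where G: "Rep (G\<^sub>o B) (G\<^sub>r B) B" if "B \<in> Obj D" for B
    using total_D by metis
  have arrC: "\<exists>A A'. h \<in> arrows C A A' \<and> A = Dom C h \<and> A' = Cod C h \<and> A \<in> Obj C \<and> A' \<in> Obj C"
    if "h \<in> Arr C" for h
    using that cat_C by (auto simp: arrows_def is_category_def)
  have arrD: "\<exists>A A'. h \<in> arrows D A A' \<and> A = Dom D h \<and> A' = Cod D h \<and> A \<in> Obj D \<and> A' \<in> Obj D"
    if "h \<in> Arr D" for h
    using that cat_D by (auto simp: arrows_def is_category_def)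
  have "\<exists>f. f \<in> arrows D (F\<^sub>o (Dom C h)) (F\<^sub>o (Cod C h)) \<and> Cor (F\<^sub>r (Dom C h)) (F\<^sub>r (Cod C h)) h f"
    if "h \<in> Arr C" for h
    using arrC[OF that] Cor_D[OF F F] by metis
  then obtain F\<^sub>a where F\<^sub>a: "h \<in> Arr C \<Longrightarrow> F\<^sub>a h \<in> arrows D (F\<^sub>o (Dom C h)) (F\<^sub>o (Cod C h)) \<and>
      Cor (F\<^sub>r (Dom C h)) (F\<^sub>r (Cod C h)) h (F\<^sub>a h)" for h
    by metis
  have "\<exists>h. h \<in> arrows C (G\<^sub>o (Dom D f)) (G\<^sub>o (Cod D f)) \<and> Cor (G\<^sub>r (Dom D f)) (G\<^sub>r (Cod D f)) h f"
    if "f \<in> Arr D" for f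
    using arrD[OF that] Cor_C[OF G G] by metis
  then obtain G\<^sub>a where G\<^sub>a: "f \<in> Arr D \<Longrightarrow> G\<^sub>a f \<in> arrows C (G\<^sub>o (Dom D f)) (G\<^sub>o (Cod D f)) \<and>
      Cor (G\<^sub>r (Dom D f)) (G\<^sub>r (Cod D f)) (G\<^sub>a f) f" for f
    by metis
  have Fa: "F\<^sub>a h \<in> arrows D (F\<^sub>o A) (F\<^sub>o A')" "Cor (F\<^sub>r A) (F\<^sub>r A') h (F\<^sub>a h)"
    if "h \<in> arrows C A A'" for h A A'
    using F\<^sub>a[of h] that by (auto simp: arrows_def)
  have Ga: "G\<^sub>a f \<in> arrows C (G\<^sub>o B) (G\<^sub>o B')" "Cor (G\<^sub>r B) (G\<^sub>r B') (G\<^sub>a f) f"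
    if "f \<in> arrows D B B'" for f B B'
    using G\<^sub>a[of f] that by (auto simp: arrows_def)
  have F\<^sub>o: "F\<^sub>o A \<in> Obj D" if "A \<in> Obj C" for A
    using F[OF that] Rep_Obj by blast
  have G\<^sub>o: "G\<^sub>o B \<in> Obj C" if "B \<in> Obj D" for B
    using G[OF that] Rep_Obj by blast
  have "\<exists>h. h \<in> arrows C A (G\<^sub>o (F\<^sub>o A)) \<and> Cor (F\<^sub>r A) (G\<^sub>r (F\<^sub>o A)) h (Ident D (F\<^sub>o A))"
    if "A \<in> Obj C" for A
    using Cor_C[OF F G] that Ident_arrow(2) F\<^sub>o by blast
  then obtain \<eta> where \<eta>: "\<eta> A \<in> arrows C A (G\<^sub>o (F\<^sub>o A))"
      "Cor (F\<^sub>r A) (G\<^sub>r (F\<^sub>o A)) (\<eta> A) (Ident D (F\<^sub>o A))" if "A \<in> Obj C" for A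
    by metis
  have "\<exists>f. f \<in> arrows D (F\<^sub>o (G\<^sub>o B)) B \<and> Cor (F\<^sub>r (G\<^sub>o B)) (G\<^sub>r B) (Ident C (G\<^sub>o B)) f"
    if "B \<in> Obj D" for B
    using Cor_D[OF F G] that Ident_arrow(1) G\<^sub>o by blast
  then obtain \<epsilon> where \<epsilon>: "\<epsilon> B \<in> arrows D (F\<^sub>o (G\<^sub>o B)) B"
      "Cor (F\<^sub>r (G\<^sub>o B)) (G\<^sub>r B) (Ident C (G\<^sub>o B)) (\<epsilon> B)" if "B \<in> Obj D" for B
    by metis
  have F_functor: "is_functor C D \<lparr>obj_map = F\<^sub>o, arr_map = F\<^sub>a\<rparr>"
    unfolding is_functor_def
  proof (intro conjI ballI impI; (simp add: F\<^sub>o F\<^sub>a)?)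
    fix A assume A: "A \<in> Obj C"
    show "F\<^sub>a (Ident C A) = Ident D (F\<^sub>o A)"
      using eq_D[OF F[OF A] F[OF A] Ident_arrow(1)[OF A]] Fa[OF Ident_arrow(1)[OF A]]
        Cor_Ident[OF F[OF A]] Ident_arrow(2)[OF F\<^sub>o[OF A]] by blast
  next
    fix f g assume "f \<in> Arr C" "g \<in> Arr C" "Cod C f = Dom C g"
    then obtain A A' A'' where f: "f \<in> arrows C A A'" and g: "g \<in> arrows C A' A''"
      and o: "A \<in> Obj C" "A' \<in> Obj C" "A'' \<in> Obj C"
      using arrC by metis
    show "F\<^sub>a (Comp C g f) = Comp D (F\<^sub>a g) (F\<^sub>a f)"
      using eq_D[OF F[OF o(1)] F[OF o(3)] Comp_arrow(1)[OF f g]] Fa[OF Comp_arrow(1)[OF f g]]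
        Cor_Comp[OF F[OF o(1)] F[OF o(2)] F[OF o(3)] f g Fa(1)[OF f] Fa(1)[OF g] Fa(2)[OF f] Fa(2)[OF g]]
        Comp_arrow(2)[OF Fa(1)[OF f] Fa(1)[OF g]] by blast
  qed
  have G_functor: "is_functor D C \<lparr>obj_map = G\<^sub>o, arr_map = G\<^sub>a\<rparr>"
    unfolding is_functor_def
  proof (intro conjI ballI impI; (simp add: G\<^sub>o G\<^sub>a)?)
    fix A assume A: "A \<in> Obj D"
    show "G\<^sub>a (Ident D A) = Ident C (G\<^sub>o A)"
      using eq_C[OF G[OF A] G[OF A] Ident_arrow(2)[OF A]] Ga[OF Ident_arrow(2)[OF A]]
        Cor_Ident[OF G[OF A]] Ident_arrow(1)[OF G\<^sub>o[OF A]] by blast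
  next
    fix f g assume "f \<in> Arr D" "g \<in> Arr D" "Cod D f = Dom D g"
    then obtain A A' A'' where f: "f \<in> arrows D A A'" and g: "g \<in> arrows D A' A''"
      and o: "A \<in> Obj D" "A' \<in> Obj D" "A'' \<in> Obj D"
      using arrD by metis
    show "G\<^sub>a (Comp D g f) = Comp C (G\<^sub>a g) (G\<^sub>a f)"
      using eq_C[OF G[OF o(1)] G[OF o(3)] Comp_arrow(2)[OF f g]] Ga[OF Comp_arrow(2)[OF f g]]
        Cor_Comp[OF G[OF o(1)] G[OF o(2)] G[OF o(3)] Ga(1)[OF f] Ga(1)[OF g] f g Ga(2)[OF f] Ga(2)[OF g]]
        Comp_arrow(1)[OF Ga(1)[OF f] Ga(1)[OF g]] by blast
  qed
  have unit: "natural_iso C C id_functor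
      (comp_functor \<lparr>obj_map = G\<^sub>o, arr_map = G\<^sub>a\<rparr> \<lparr>obj_map = F\<^sub>o, arr_map = F\<^sub>a\<rparr>) \<eta>"
    unfolding natural_iso_def
  proof (intro conjI ballI; (simp add: id_functor_def comp_functor_def)?)
    fix A assume A: "A \<in> Obj C"
    show "\<eta> A \<in> arrows C A (G\<^sub>o (F\<^sub>o A))" using \<eta> A by simp
    show "is_iso C (\<eta> A)"
      using iso_C[OF F[OF A] G[OF F\<^sub>o[OF A]]] \<eta>[OF A] by simp
  next
    fix h assume "h \<in> Arr C"
    then obtain A A' where h: "h \<in> arrows C A A'" "A = Dom C h" "A' = Cod C h"
      and o: "A \<in> Obj C" "A' \<in> Obj C"
      using arrC by metis
    \<comment> \<open>both composites correspond to the arrow \<open>F h\<close>, composed with an identity of \<open>D\<close>\<close>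
    have "Cor (F\<^sub>r A) (G\<^sub>r (F\<^sub>o A')) (Comp C (\<eta> A') h) (F\<^sub>a h)"
      using Cor_Comp[OF F[OF o(1)] F[OF o(2)] G[OF F\<^sub>o[OF o(2)]] h(1) \<eta>(1)[OF o(2)] Fa(1)[OF h(1)]
          Ident_arrow(2)[OF F\<^sub>o[OF o(2)]] Fa(2)[OF h(1)] \<eta>(2)[OF o(2)]]
        Comp_Ident(2)[OF Fa(1)[OF h(1)]] by simp
    moreover have "Cor (F\<^sub>r A) (G\<^sub>r (F\<^sub>o A')) (Comp C (G\<^sub>a (F\<^sub>a h)) (\<eta> A)) (F\<^sub>a h)"
      using Cor_Comp[OF F[OF o(1)] G[OF F\<^sub>o[OF o(1)]] G[OF F\<^sub>o[OF o(2)]] \<eta>(1)[OF o(1)]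
          Ga(1)[OF Fa(1)[OF h(1)]] Ident_arrow(2)[OF F\<^sub>o[OF o(1)]] Fa(1)[OF h(1)]
          \<eta>(2)[OF o(1)] Ga(2)[OF Fa(1)[OF h(1)]]]
        Comp_Ident(2)[OF Fa(1)[OF h(1)]] by simp
    ultimately show "Comp C (\<eta> (Cod C h)) h = Comp C (G\<^sub>a (F\<^sub>a h)) (\<eta> (Dom C h))"
      using eq_C[OF F[OF o(1)] G[OF F\<^sub>o[OF o(2)]] Fa(1)[OF h(1)] Comp_arrow(1)[OF h(1) \<eta>(1)[OF o(2)]]
          Comp_arrow(1)[OF \<eta>(1)[OF o(1)] Ga(1)[OF Fa(1)[OF h(1)]]]] h(2,3) by simp
  qed
  have counit: "natural_iso D D
      (comp_functor \<lparr>obj_map = F\<^sub>o, arr_map = F\<^sub>a\<rparr> \<lparr>obj_map = G\<^sub>o, arr_map = G\<^sub>a\<rparr>) id_functor \<epsilon>"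
    unfolding natural_iso_def
  proof (intro conjI ballI; (simp add: id_functor_def comp_functor_def)?)
    fix B assume B: "B \<in> Obj D"
    show "\<epsilon> B \<in> arrows D (F\<^sub>o (G\<^sub>o B)) B" using \<epsilon> B by simp
    show "is_iso D (\<epsilon> B)"
      using conv.iso_C[OF F[OF G\<^sub>o[OF B]] G[OF B]] \<epsilon>[OF B] by simp
  next
    fix f assume "f \<in> Arr D"
    then obtain B B' where f: "f \<in> arrows D B B'" "B = Dom D f" "B' = Cod D f"
      and o: "B \<in> Obj D" "B' \<in> Obj D"
      using arrD by metis
    have "Cor (F\<^sub>r (G\<^sub>o B)) (G\<^sub>r B') (G\<^sub>a f) (Comp D (\<epsilon> B') (F\<^sub>a (G\<^sub>a f)))"
      using Cor_Comp[OF F[OF G\<^sub>o[OF o(1)]] F[OF G\<^sub>o[OF o(2)]] G[OF o(2)] Ga(1)[OF f(1)]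
          Ident_arrow(1)[OF G\<^sub>o[OF o(2)]] Fa(1)[OF Ga(1)[OF f(1)]] \<epsilon>(1)[OF o(2)]
          Fa(2)[OF Ga(1)[OF f(1)]] \<epsilon>(2)[OF o(2)]]
        Comp_Ident(1)[OF Ga(1)[OF f(1)]] by simp
    moreover have "Cor (F\<^sub>r (G\<^sub>o B)) (G\<^sub>r B') (G\<^sub>a f) (Comp D f (\<epsilon> B))"
      using Cor_Comp[OF F[OF G\<^sub>o[OF o(1)]] G[OF o(1)] G[OF o(2)] Ident_arrow(1)[OF G\<^sub>o[OF o(1)]]
          Ga(1)[OF f(1)] \<epsilon>(1)[OF o(1)] f(1) \<epsilon>(2)[OF o(1)] Ga(2)[OF f(1)]]
        Comp_Ident(1)[OF Ga(1)[OF f(1)]] by simp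
    ultimately show "Comp D (\<epsilon> (Cod D f)) (F\<^sub>a (G\<^sub>a f)) = Comp D f (\<epsilon> (Dom D f))"
      using eq_D[OF F[OF G\<^sub>o[OF o(1)]] G[OF o(2)] Ga(1)[OF f(1)]
          Comp_arrow(2)[OF Fa(1)[OF Ga(1)[OF f(1)]] \<epsilon>(1)[OF o(2)]]
          Comp_arrow(2)[OF \<epsilon>(1)[OF o(1)] f(1)]] f(2,3) by simp
  qed
  show ?thesis
    unfolding equivalent_categories_def
    using cat_C cat_D F_functor G_functor unit counit by blast
qed

end

lemma concrete_category_is_category:
  assumes S: "\<And>A B f. \<lbrakk>A \<in> Os; B \<in> Os; M A B f\<rbrakk> \<Longrightarrow> f \<in> S A \<rightarrow> S B"
    and idn: "\<And>A. A \<in> Os \<Longrightarrow> M A A (restrict id (S A))"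
    and cmp: "\<And>A B C f g. \<lbrakk>A \<in> Os; B \<in> Os; C \<in> Os; M A B f; M B C g\<rbrakk> \<Longrightarrow> M A C (compose (S A) g f)"
  shows "is_category (concrete_category Os S M)"
  unfolding is_category_def
proof (intro conjI ballI impI, goal_cases)
  case (5 f)
  then show ?case
    using S by (auto simp: concrete_category_def compose_def extensional_def fun_eq_iff)
next
  case (6 f)
  then obtain A u B where f: "f = (A, u, B)" "A \<in> Os" "B \<in> Os" "M A B u" "u \<in> extensional (S A)"
    by (auto simp: concrete_category_def)
  have "compose (S A) (restrict id (S B)) u = u"
    using S[OF f(2-4)] f(5) by (intro extensionalityI[of _ "S A"]) (auto simp: compose_eq)
  then show ?case using f(1) by (simp add: concrete_category_def)
next
  case (7 f g h)
  obtain A u B where f: "f = (A, u, B)" "A \<in> Os" "B \<in> Os" "M A B u"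
    using 7(1) by (auto simp: concrete_category_def)
  obtain B' v C where g: "g = (B', v, C)"
    using 7(2) by (auto simp: concrete_category_def)
  obtain C' w D where h: "h = (C', w, D)"
    using 7(3) by (auto simp: concrete_category_def)
  have "B' = B" using 7(4) f(1) g by (simp add: concrete_category_def)
  then show ?case
    using compose_assoc[OF S[OF f(2-4)]] f(1) g h by (simp add: concrete_category_def)
qed (auto simp: concrete_category_def arrows_def idn intro: cmp)

lemma op_category_is_category: "is_category C \<Longrightarrow> is_category (op_category C)"
  unfolding is_category_def op_category_def arrows_def by simp

section \<open>Compactness in Priestley spaces\<close>

text \<open>
  The form in which compactness is used throughout. A point of \<open>G\<close> can be excluded by a member of a
  filter base \<open>\<P>\<close> of closed sets or caught by a member of an ideal base \<open>\<N>\<close> of open sets; if this is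
  possible for each point, one member of either kind serves for all points together.
\<close>
lemma compactin_cover_pair:
  assumes G: "compactin T G"
    and \<P>: "\<And>U. U \<in> \<P> \<Longrightarrow> closedin T U" "topspace T \<in> \<P>" "\<And>U U'. \<lbrakk>U \<in> \<P>; U' \<in> \<P>\<rbrakk> \<Longrightarrow> U \<inter> U' \<in> \<P>"
    and \<N>: "\<And>V. V \<in> \<N> \<Longrightarrow> openin T V" "{} \<in> \<N>" "\<And>V V'. \<lbrakk>V \<in> \<N>; V' \<in> \<N>\<rbrakk> \<Longrightarrow> V \<union> V' \<in> \<N>"
    and sep: "\<And>y. y \<in> G \<Longrightarrow> (\<exists>U\<in>\<P>. y \<notin> U) \<or> (\<exists>V\<in>\<N>. y \<in> V)"
  shows "\<exists>U\<in>\<P>. \<exists>V\<in>\<N>. G \<inter> U \<subseteq> V"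
proof -
  have GT: "G \<subseteq> topspace T"
    using G by (simp add: compactin_subset_topspace)
  have "G \<subseteq> \<Union>((\<lambda>U. topspace T - U) ` \<P> \<union> \<N>)"
  proof
    fix y assume "y \<in> G"
    then show "y \<in> \<Union>((\<lambda>U. topspace T - U) ` \<P> \<union> \<N>)"
      using sep[of y] GT by auto
  qed
  moreover have "openin T O'" if "O' \<in> (\<lambda>U. topspace T - U) ` \<P> \<union> \<N>" for O'
    using that \<P>(1) \<N>(1) by blast
  ultimately obtain \<F> where \<F>: "finite \<F>" "\<F> \<subseteq> (\<lambda>U. topspace T - U) ` \<P> \<union> \<N>" "G \<subseteq> \<Union>\<F>"
    using compactinD[OF G] by meson
  have "\<exists>U\<in>\<P>. \<exists>V\<in>\<N>. \<Union>\<F> \<inter> U \<subseteq> V"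
    using \<F>(1,2)
  proof (induction rule: finite_induct)
    case empty
    then show ?case using \<P>(2) \<N>(2) by blast
  next
    case (insert O' \<F>)
    then obtain U V where UV: "U \<in> \<P>" "V \<in> \<N>" "\<Union>\<F> \<inter> U \<subseteq> V" by blast
    show ?case
    proof (cases "O' \<in> \<N>")
      case True
      then show ?thesis using UV \<N>(3) by (intro bexI[of _ U] bexI[of _ "O' \<union> V"]) auto
    next
      case False
      then obtain U' where "U' \<in> \<P>" "O' = topspace T - U'" using insert.prems by blast
      then show ?thesis using UV \<P>(3) by (intro bexI[of _ "U' \<inter> U"] bexI[of _ V]) auto
    qed
  qed
  then show ?thesis using \<F>(3) by blast
qed

text \<open>
  A lattice of clopen sets that separates the points of one compact set from those of another
  separates the two sets. Two covering arguments: first a single point against \<open>G\<close>, then \<open>F\<close>. Besides the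
  lattice of all clopen upsets, the lemma is used for the basic clopen upsets of a space of prime
  filters, where it shows that there are no others.
\<close>
lemma separate_compact_sets:
  assumes FG: "compactin T F" "compactin T G"
    and \<B>: "\<And>U. U \<in> \<B> \<Longrightarrow> openin T U \<and> closedin T U" "topspace T \<in> \<B>" "{} \<in> \<B>"
      "\<And>U V. \<lbrakk>U \<in> \<B>; V \<in> \<B>\<rbrakk> \<Longrightarrow> U \<inter> V \<in> \<B>" "\<And>U V. \<lbrakk>U \<in> \<B>; V \<in> \<B>\<rbrakk> \<Longrightarrow> U \<union> V \<in> \<B>"
    and sep: "\<And>x y. \<lbrakk>x \<in> F; y \<in> G\<rbrakk> \<Longrightarrow> \<exists>U\<in>\<B>. x \<in> U \<and> y \<notin> U"
  shows "\<exists>U\<in>\<B>. F \<subseteq> U \<and> U \<inter> G = {}"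
proof -
  have "\<exists>V\<in>{V\<in>\<B>. V \<inter> G = {}}. x \<in> V" if x: "x \<in> F" for x
  proof -
    have xT: "x \<in> topspace T"
      using x FG(1) compactin_subset_topspace by blast
    have "\<exists>U\<in>{U\<in>\<B>. x \<in> U}. \<exists>V\<in>{{}}. G \<inter> U \<subseteq> V"
    proof (rule compactin_cover_pair[OF FG(2)])
      fix y assume "y \<in> G"
      then show "(\<exists>U\<in>{U\<in>\<B>. x \<in> U}. y \<notin> U) \<or> (\<exists>V\<in>{{}}. y \<in> V)"
        using sep[OF x] by blast
    qed (simp_all add: \<B> x xT)
    then show ?thesis by blast
  qed
  then have "\<exists>U\<in>{topspace T}. \<exists>V\<in>{V\<in>\<B>. V \<inter> G = {}}. F \<inter> U \<subseteq> V"
    by (intro compactin_cover_pair[OF FG(1)]) (simp_all add: \<B> Int_Un_distrib2)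
  then obtain V where V: "V \<in> \<B>" "V \<inter> G = {}" "F \<inter> topspace T \<subseteq> V" by auto
  have "F \<subseteq> V"
    using V(3) compactin_subset_topspace[OF FG(1)] by (simp add: Int_absorb2)
  then show ?thesis
    using V by (intro bexI[of _ V] conjI)
qed

lemma upset_subset: "upset X S \<Longrightarrow> S \<subseteq> points X"
  unfolding upset_def by (rule conjunct1)

lemma ClopUpD:
  assumes "U \<in> ClopUp X"
  shows "openin (topo X) U" "closedin (topo X) U" "upset X U" "open_upset X U" "U \<subseteq> points X"
proof -
  have *: "openin (topo X) U" "closedin (topo X) U" "upset X U"
    using assms by (simp_all add: ClopUp_def clopen_def)
  then show "openin (topo X) U" "closedin (topo X) U" "upset X U" "open_upset X U" "U \<subseteq> points X"
    by (simp_all add: open_upset_def openin_subset)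
qed

lemma clopenI: "openin (topo X) U \<Longrightarrow> closedin (topo X) U \<Longrightarrow> clopen X U"
  by (simp add: clopen_def)

locale priestley =
  fixes X :: "'p ordered_space"
  assumes priestley: "priestley_space X"
begin

lemma compact: "compact_space (topo X)"
  using priestley by (simp add: priestley_space_def)

lemma closed_compact: "closedin (topo X) F \<Longrightarrow> compactin (topo X) F"
  by (simp add: closedin_compact_space compact)

lemma ord_points: "(x, y) \<in> ord X \<Longrightarrow> x \<in> points X \<and> y \<in> points X"
  using priestley by (auto simp: priestley_space_def order_on_defs)

lemma ord_refl: "x \<in> points X \<Longrightarrow> (x, x) \<in> ord X"
  using priestley by (auto simp: priestley_space_def order_on_defs refl_on_def)

lemma ord_trans: "\<lbrakk>(x, y) \<in> ord X; (y, z) \<in> ord X\<rbrakk> \<Longrightarrow> (x, z) \<in> ord X"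
  using priestley by (auto simp: priestley_space_def order_on_defs dest: transD)

lemma ord_antisym: "\<lbrakk>(x, y) \<in> ord X; (y, x) \<in> ord X\<rbrakk> \<Longrightarrow> x = y"
  using priestley by (auto simp: priestley_space_def order_on_defs dest: antisymD)

lemma ord_separated:
  "\<lbrakk>x \<in> points X; y \<in> points X; (x, y) \<notin> ord X\<rbrakk> \<Longrightarrow> \<exists>U\<in>ClopUp X. x \<in> U \<and> y \<notin> U"
  using priestley by (simp add: priestley_space_def)

lemma upset_iff: "upset X S \<longleftrightarrow> S \<subseteq> points X \<and> (\<forall>x\<in>S. \<forall>y. (x, y) \<in> ord X \<longrightarrow> y \<in> S)"
  unfolding upset_def up_def using ord_points ord_refl by blast

lemma upset_up: "\<lbrakk>upset X S; x \<in> S; (x, y) \<in> ord X\<rbrakk> \<Longrightarrow> y \<in> S"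
  by (simp add: upset_iff)

lemma ClopUp_iff: "U \<in> ClopUp X \<longleftrightarrow> openin (topo X) U \<and> closedin (topo X) U \<and>
    (\<forall>x\<in>U. \<forall>y. (x, y) \<in> ord X \<longrightarrow> y \<in> U)"
  unfolding ClopUp_def clopen_def upset_iff using openin_subset by blast

lemma open_upset_iff: "open_upset X U \<longleftrightarrow> openin (topo X) U \<and>
    (\<forall>x\<in>U. \<forall>y. (x, y) \<in> ord X \<longrightarrow> y \<in> U)"
  unfolding open_upset_def upset_iff using openin_subset by blast

lemma down_iff: "y \<in> down X S \<longleftrightarrow> (\<exists>x\<in>S. (y, x) \<in> ord X)"
  unfolding down_def using ord_points by blast

lemma down_Union: "down X (\<Union>\<D>) = (\<Union>S\<in>\<D>. down X S)"
  by (rule Set.set_eqI) (simp add: down_iff, blast?)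

lemma ClopUp_lattice:
  "{} \<in> ClopUp X" "points X \<in> ClopUp X"
  "\<lbrakk>U \<in> ClopUp X; V \<in> ClopUp X\<rbrakk> \<Longrightarrow> U \<inter> V \<in> ClopUp X"
  "\<lbrakk>U \<in> ClopUp X; V \<in> ClopUp X\<rbrakk> \<Longrightarrow> U \<union> V \<in> ClopUp X"
  using ord_points by (auto simp: ClopUp_iff)

lemma ClopUp_Inter: "finite \<K> \<Longrightarrow> \<K> \<subseteq> ClopUp X \<Longrightarrow> points X \<inter> \<Inter>\<K> \<in> ClopUp X"
proof (induction rule: finite_induct)
  case (insert U \<K>)
  have "points X \<inter> \<Inter>(insert U \<K>) = U \<inter> (points X \<inter> \<Inter>\<K>)" by blast
  then show ?case using insert ClopUp_lattice(3) by simp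
qed (simp add: ClopUp_lattice)

lemma ClopUp_Union: "finite \<K> \<Longrightarrow> \<K> \<subseteq> ClopUp X \<Longrightarrow> \<Union>\<K> \<in> ClopUp X"
  by (induction rule: finite_induct) (auto simp: ClopUp_lattice)

lemma open_upset_Union: "\<K> \<subseteq> ClopUp X \<Longrightarrow> open_upset X (\<Union>\<K>)"
  unfolding open_upset_iff using ClopUp_iff by (metis UnionE UnionI openin_Union subsetD)

lemma separate_by_ClopUp:
  assumes "compactin (topo X) F" "compactin (topo X) G"
    and "\<And>x y. \<lbrakk>x \<in> F; y \<in> G\<rbrakk> \<Longrightarrow> (x, y) \<notin> ord X"
  shows "\<exists>U\<in>ClopUp X. F \<subseteq> U \<and> U \<inter> G = {}"
proof (rule separate_compact_sets[OF assms(1,2)])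
  fix x y assume "x \<in> F" "y \<in> G"
  then show "\<exists>U\<in>ClopUp X. x \<in> U \<and> y \<notin> U"
    using compactin_subset_topspace[OF assms(1)] compactin_subset_topspace[OF assms(2)]
    by (intro ord_separated assms(3)) auto
qed (simp_all add: ClopUp_lattice ClopUpD)

lemma closed_down:
  assumes "compactin (topo X) G"
  shows "closedin (topo X) (down X G)"
proof -
  have "\<exists>U. openin (topo X) U \<and> z \<in> U \<and> U \<subseteq> points X - down X G" if z: "z \<in> points X - down X G" for z
  proof -
    obtain U where U: "U \<in> ClopUp X" "{z} \<subseteq> U" "U \<inter> G = {}"
      using separate_by_ClopUp[of "{z}" G] assms z down_iff by (auto simp: compactin_sing)
    have "U \<inter> down X G = {}"
    proof (rule ccontr)
      assume "U \<inter> down X G \<noteq> {}"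
      then obtain x g where "x \<in> U" "g \<in> G" "(x, g) \<in> ord X" by (auto simp: down_iff)
      then have "g \<in> U" using U(1) by (auto simp: ClopUp_iff)
      then show False using U(3) \<open>g \<in> G\<close> by blast
    qed
    then show ?thesis using U(2) ClopUpD[OF U(1)] by (intro exI[of _ U]) auto
  qed
  then have "openin (topo X) (points X - down X G)"
    by (subst openin_subopen) blast
  then show ?thesis
    by (auto simp: closedin_def down_def)
qed

lemma closed_upset_below_open:
  assumes "closedin (topo X) F" "upset X F" "openin (topo X) O'" "F \<subseteq> O'"
  shows "\<exists>U\<in>ClopUp X. F \<subseteq> U \<and> U \<subseteq> O'"
proof -
  have "\<exists>U\<in>ClopUp X. F \<subseteq> U \<and> U \<inter> (points X - O') = {}"
  proof (rule separate_by_ClopUp)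
    show "compactin (topo X) F" "compactin (topo X) (points X - O')"
      using assms by (auto intro: closed_compact)
    show "(x, y) \<notin> ord X" if "x \<in> F" "y \<in> points X - O'" for x y
      using that upset_up[OF assms(2)] assms(4) by blast
  qed
  then show ?thesis using ClopUpD(5) by blast
qed

text \<open>
  No point of \<open>F\<close> is below a point of \<open>G - O'\<close>, since otherwise the latter would be in \<open>F\<close> as well. So \<open>F\<close> can
  be enlarged to a clopen upset that still meets \<open>G\<close> inside \<open>O'\<close>, and then \<open>G\<close> likewise.
\<close>
lemma closed_upsets_meet_below_open:
  assumes F: "closedin (topo X) F" "upset X F" and G: "closedin (topo X) G" "upset X G"
    and O': "openin (topo X) O'" "F \<inter> G \<subseteq> O'"
  shows "\<exists>U\<in>ClopUp X. \<exists>V\<in>ClopUp X. F \<subseteq> U \<and> G \<subseteq> V \<and> U \<inter> V \<subseteq> O'"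
proof -
  have "\<exists>U\<in>ClopUp X. F \<subseteq> U \<and> U \<subseteq> (points X - G) \<union> O'"
  proof -
    have "\<exists>U\<in>ClopUp X. F \<subseteq> U \<and> U \<inter> (G - O') = {}"
    proof (rule separate_by_ClopUp)
      show "compactin (topo X) (G - O')"
        using G O' by (intro closed_compact) (simp add: closedin_diff)
      show "compactin (topo X) F" using F(1) by (rule closed_compact)
      show "(x, y) \<notin> ord X" if "x \<in> F" "y \<in> G - O'" for x y
        using that upset_up[OF F(2)] O'(2) by blast
    qed
    then obtain U where "U \<in> ClopUp X" "F \<subseteq> U" "U \<inter> (G - O') = {}" by (elim bexE conjE)
    then show ?thesis using ClopUpD(5)[of U X] by (intro bexI[of _ U]) auto
  qed
  then obtain U where U: "U \<in> ClopUp X" "F \<subseteq> U" "U \<subseteq> (points X - G) \<union> O'"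
    by (elim bexE conjE)
  have "openin (topo X) ((points X - U) \<union> O')"
    using ClopUpD(2)[OF U(1)] O'(1) by blast
  moreover have "G \<subseteq> (points X - U) \<union> O'"
    using U(3) upset_subset[OF G(2)] by auto
  ultimately obtain V where "V \<in> ClopUp X" "G \<subseteq> V" "V \<subseteq> (points X - U) \<union> O'"
    using closed_upset_below_open[OF G, of "(points X - U) \<union> O'"] by auto
  then show ?thesis using U by (intro bexI[of _ U] bexI[of _ V]) auto
qed

lemma open_upset_eq_Union:
  assumes "open_upset X W"
  shows "W = \<Union>{U \<in> ClopUp X. U \<subseteq> W}"
proof -
  have "\<exists>U\<in>ClopUp X. x \<in> U \<and> U \<subseteq> W" if x: "x \<in> W" for x
  proof -
    have W: "openin (topo X) W" "W \<subseteq> points X" "\<forall>x\<in>W. \<forall>y. (x, y) \<in> ord X \<longrightarrow> y \<in> W"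
      using assms openin_subset unfolding open_upset_iff by auto
    then have "\<exists>U\<in>ClopUp X. {x} \<subseteq> U \<and> U \<inter> (points X - W) = {}"
      using x by (intro separate_by_ClopUp closed_compact[of "points X - W"] closedin_diff closedin_topspace)
        (auto simp: compactin_sing)
    then obtain U where "U \<in> ClopUp X" "{x} \<subseteq> U" "U \<inter> (points X - W) = {}" by (elim bexE conjE)
    then show ?thesis using ClopUpD(5)[of U X] by (intro bexI[of _ U]) auto
  qed
  then show ?thesis by blast
qed

text \<open>
  Points \<open>y \<noteq> x\<close> satisfy \<open>\<not> x \<le> y\<close> or \<open>\<not> y \<le> x\<close>, so \<open>y\<close> is avoided by a clopen upset around \<open>x\<close> or caught by one
  that misses \<open>x\<close>.
\<close>
lemma clopen_basis:
  assumes "openin (topo X) O'" "x \<in> O'"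
  shows "\<exists>U\<in>ClopUp X. \<exists>V\<in>ClopUp X. x \<in> U - V \<and> U - V \<subseteq> O'"
proof -
  have x: "x \<in> points X" using assms openin_subset by blast
  have "\<exists>U\<in>{U\<in>ClopUp X. x \<in> U}. \<exists>V\<in>{V\<in>ClopUp X. x \<notin> V}. (points X - O') \<inter> U \<subseteq> V"
  proof (rule compactin_cover_pair)
    show "compactin (topo X) (points X - O')"
      using assms(1) by (intro closed_compact closedin_diff closedin_topspace)
    fix y assume y: "y \<in> points X - O'"
    then have "(x, y) \<notin> ord X \<or> (y, x) \<notin> ord X"
      using assms(2) ord_antisym by blast
    then show "(\<exists>U\<in>{U \<in> ClopUp X. x \<in> U}. y \<notin> U) \<or> (\<exists>V\<in>{V \<in> ClopUp X. x \<notin> V}. y \<in> V)"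
      using ord_separated[of x y] ord_separated[of y x] x y by auto
  qed (use x in \<open>auto simp: ClopUp_lattice ClopUpD\<close>)
  then obtain U V where "U \<in> ClopUp X" "x \<in> U" "V \<in> ClopUp X" "x \<notin> V" "(points X - O') \<inter> U \<subseteq> V"
    by auto
  then show ?thesis
    using ClopUpD(5)[of U X] by (intro bexI[of _ U] bexI[of _ V]) auto
qed

lemma finite_subcover_by_directed:
  assumes "compactin (topo X) F" "F \<subseteq> \<Union>\<K>" "\<K> \<subseteq> ClopUp X" "{} \<in> \<K>"
    and "\<And>U V. \<lbrakk>U \<in> \<K>; V \<in> \<K>\<rbrakk> \<Longrightarrow> U \<union> V \<in> \<K>"
  shows "\<exists>U\<in>\<K>. F \<subseteq> U"
proof -
  have "openin (topo X) V" if "V \<in> \<K>" for V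
    using that assms(3) ClopUpD(1)[of V X] by blast
  then have "\<exists>U\<in>{points X}. \<exists>V\<in>\<K>. F \<inter> U \<subseteq> V"
    using assms(2,4,5) by (intro compactin_cover_pair[OF assms(1)]) auto
  then show ?thesis using compactin_subset_topspace[OF assms(1)] by blast
qed

text \<open>
  Zorn's lemma: the sets \<open>F \<inter> down c\<close>, for \<open>c\<close> in a chain of points of \<open>F\<close>, are closed and have the finite
  intersection property, and a common point of them is a lower bound of the chain in \<open>F\<close>.
\<close>
lemma minimal_below:
  assumes F: "closedin (topo X) F" and x: "x \<in> F"
  shows "\<exists>m\<in>minimal X F. (m, x) \<in> ord X"
proof -
  have FX: "F \<subseteq> points X" using F closedin_subset by blast
  define A where "A = F \<inter> down X {x}"
  have "\<exists>m\<in>A. \<forall>a\<in>A. (a, m) \<in> ord X \<longrightarrow> a = m"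
  proof (rule predicate_Zorn)
    show "partial_order_on A (relation_of (\<lambda>a b. (b, a) \<in> ord X) A)"
      by (rule partial_order_on_relation_ofI) (use FX ord_refl ord_trans ord_antisym in \<open>auto simp: A_def\<close>)
  next
    fix C assume "C \<in> Chains (relation_of (\<lambda>a b. (b, a) \<in> ord X) A)"
    then have C: "C \<subseteq> A" "\<And>a b. \<lbrakk>a \<in> C; b \<in> C\<rbrakk> \<Longrightarrow> (a, b) \<in> ord X \<or> (b, a) \<in> ord X"
      by (auto simp: Chains_def relation_of_def)
    show "\<exists>u\<in>A. \<forall>a\<in>C. (u, a) \<in> ord X"
    proof (cases "C = {}")
      case True
      then show ?thesis using x FX ord_refl by (auto simp: A_def down_iff)
    next
      case False
      have closed: "closedin (topo X) (F \<inter> down X {c})" if "c \<in> C" for c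
        using that C(1) FX F by (intro closedin_Int closed_down) (auto simp: A_def compactin_sing)
      have fin: "\<exists>m\<in>C'. \<forall>c\<in>C'. (m, c) \<in> ord X" if "finite C'" "C' \<noteq> {}" "C' \<subseteq> C" for C'
        using that
      proof (induction rule: finite_ne_induct)
        case (singleton c)
        then show ?case using C(1) FX ord_refl by (auto simp: A_def)
      next
        case (insert c C')
        then obtain m where m: "m \<in> C'" "\<forall>c\<in>C'. (m, c) \<in> ord X" by blast
        have "m \<in> C" "c \<in> C" using m insert.prems by auto
        then have "(m, c) \<in> ord X \<or> (c, m) \<in> ord X" "(c, c) \<in> ord X"
          using C(2) by (blast, blast)
        then show ?case using m ord_trans by blast
      qed
      have "\<Inter>\<F> \<noteq> {}" if \<F>: "finite \<F>" "\<F> \<subseteq> (\<lambda>c. F \<inter> down X {c}) ` C" for \<F>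
      proof (cases "\<F> = {}")
        case False
        obtain C' where C': "C' \<subseteq> C" "finite C'" "\<F> = (\<lambda>c. F \<inter> down X {c}) ` C'"
          using finite_subset_image[OF \<F>] by blast
        then obtain m where m: "m \<in> C'" "\<forall>c\<in>C'. (m, c) \<in> ord X"
          using fin[of C'] False by blast
        then have "m \<in> \<Inter>\<F>"
          using C' C(1) by (auto simp: A_def down_iff)
        then show ?thesis by blast
      qed simp
      then have "\<Inter>((\<lambda>c. F \<inter> down X {c}) ` C) \<noteq> {}"
        using closed by (intro mp[OF spec[OF compact[unfolded compact_space_fip]]]) auto
      then obtain z where z': "z \<in> \<Inter>((\<lambda>c. F \<inter> down X {c}) ` C)" by blast
      have z: "z \<in> F \<and> (z, c) \<in> ord X" if "c \<in> C" for c
        using INT_D[OF z' that] by (simp add: down_iff)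
      moreover have "z \<in> A"
      proof -
        obtain c where c: "c \<in> C" using False by blast
        then have "(c, x) \<in> ord X" using C(1) by (auto simp: A_def down_iff)
        then show ?thesis using z[OF c] ord_trans by (auto simp: A_def down_iff)
      qed
      ultimately show ?thesis by blast
    qed
  qed
  then obtain m where m: "m \<in> F" "(m, x) \<in> ord X" "\<And>a. \<lbrakk>a \<in> F; (a, x) \<in> ord X; (a, m) \<in> ord X\<rbrakk> \<Longrightarrow> a = m"
    by (auto simp: A_def down_iff)
  then have "m \<in> minimal X F"
    using ord_trans unfolding minimal_def by blast
  then show ?thesis using m(2) by (rule bexI[rotated])
qed

text \<open>
  Down-sets commute with unions, and every clopen set is a union of differences of clopen upsets.
\<close>
lemma esakiaI:
  assumes "\<And>U V. \<lbrakk>U \<in> ClopUp X; V \<in> ClopUp X\<rbrakk> \<Longrightarrow> openin (topo X) (down X (U - V))"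
  shows "esakia_space X"
proof -
  have "clopen X (down X C)" if C: "clopen X C" for C
  proof (rule clopenI)
    define \<D> where "\<D> = {U - V | U V. U \<in> ClopUp X \<and> V \<in> ClopUp X \<and> U - V \<subseteq> C}"
    have "C = \<Union>\<D>"
    proof (intro equalityI subsetI)
      fix x assume "x \<in> C"
      then obtain U V where "U \<in> ClopUp X" "V \<in> ClopUp X" "x \<in> U - V" "U - V \<subseteq> C"
        using clopen_basis[of C x] C unfolding clopen_def by metis
      then show "x \<in> \<Union>\<D>" unfolding \<D>_def
        by (intro UnionI[of "U - V"] CollectI exI[of _ U] exI[of _ V] conjI refl)
    qed (auto simp: \<D>_def)
    then have "down X C = \<Union>(down X ` \<D>)"
      by (simp add: down_Union)
    moreover have "openin (topo X) (\<Union>(down X ` \<D>))"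
      using assms by (intro openin_Union) (auto simp: \<D>_def)
    ultimately show "openin (topo X) (down X C)" by simp
    show "closedin (topo X) (down X C)"
      using C by (intro closed_down closed_compact) (simp add: clopen_def)
  qed
  then show ?thesis
    using priestley by (simp add: esakia_space_def)
qed

text \<open>
  If \<open>x \<le> y\<close> and \<open>y\<close> has a clopen neighbourhood \<open>N\<close> that misses the upset \<open>S\<close>, then the down-set of \<open>N\<close> is an
  open neighbourhood of \<open>x\<close> that misses \<open>S\<close>.
\<close>
lemma closure_upset:
  assumes "esakia_space X" "upset X S"
  shows "upset X (cl X S)"
  unfolding upset_iff
proof (intro conjI ballI allI impI)
  show "cl X S \<subseteq> points X" by (rule closure_of_subset_topspace)
  fix x y assume x: "x \<in> cl X S" and xy: "(x, y) \<in> ord X"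
  show "y \<in> cl X S"
  proof (rule ccontr)
    assume y: "y \<notin> cl X S"
    have y': "y \<in> points X - cl X S" using y xy ord_points by blast
    have "openin (topo X) (points X - cl X S)" by (simp add: openin_diff)
    then obtain U V where UV: "U \<in> ClopUp X" "V \<in> ClopUp X" "y \<in> U - V" "U - V \<subseteq> points X - cl X S"
      using clopen_basis y' by metis
    then have "clopen X (U - V)"
      by (simp add: clopen_def openin_diff closedin_diff ClopUpD)
    then have "openin (topo X) (down X (U - V))"
      using assms(1) by (simp add: esakia_space_def clopen_def)
    moreover have "x \<in> down X (U - V)"
      using xy UV(3) down_iff by blast
    ultimately obtain s where "s \<in> S" "s \<in> down X (U - V)"
      using x unfolding in_closure_of by blast
    then obtain u where "u \<in> U - V" "u \<in> S"
      using assms(2) unfolding down_iff upset_iff by blast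
    then show False
      using UV(4) closure_of_subset[of S "topo X"] assms(2) upset_iff by blast
  qed
qed

end

section \<open>Scott upsets and kernels in L-spaces\<close>

locale l_space = priestley +
  assumes l_space: "L_space X"
begin

lemma cl_upset: "upset X S \<Longrightarrow> upset X (cl X S)"
  using closure_upset l_space by (simp add: L_space_def)

lemma cl_ClopUp: "open_upset X W \<Longrightarrow> cl X W \<in> ClopUp X"
  using l_space cl_upset by (simp add: ClopUp_def clopen_def L_space_def open_upset_def)

lemma open_upset_subset_cl: "open_upset X W \<Longrightarrow> W \<subseteq> cl X W"
  by (simp add: open_upset_def closure_of_subset openin_subset)

lemma cl_ClopUp_eq: "U \<in> ClopUp X \<Longrightarrow> cl X U = U"
  by (simp add: ClopUpD closure_of_closedin)

text \<open>
  A minimal point \<open>m\<close> of \<open>F\<close> lies in the localic part iff \<open>down m\<close> is a neighbourhood of \<open>m\<close>, that is, iff \<open>m\<close> is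
  not in the closure of the open upset \<open>X - down m\<close>. In that case \<open>m \<in> cl W\<close> forces \<open>m \<in> W\<close> for each upset \<open>W\<close>.
  Otherwise \<open>W = X - down m\<close> satisfies \<open>F \<subseteq> cl W\<close>, because \<open>m\<close> is the only point of \<open>F\<close> outside \<open>W\<close>, but not
  \<open>F \<subseteq> W\<close>.
\<close>
lemma scott_upset_iff:
  assumes F: "closedin (topo X) F" "upset X F"
  shows "scott_upset X F \<longleftrightarrow> (\<forall>W. open_upset X W \<longrightarrow> F \<subseteq> cl X W \<longrightarrow> F \<subseteq> W)"
proof (intro iffI allI impI subsetI)
  fix W x assume scott: "scott_upset X F" and W: "open_upset X W" "F \<subseteq> cl X W" and x: "x \<in> F"
  obtain m where m: "m \<in> minimal X F" "(m, x) \<in> ord X"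
    using minimal_below[OF F(1) x] by blast
  then have "openin (topo X) (down X {m})" "m \<in> cl X W"
    using scott W(2) by (auto simp: scott_upset_def localic_part_def clopen_def minimal_def)
  moreover have "m \<in> down X {m}"
    using m ord_refl ord_points by (simp add: down_iff)
  ultimately obtain w where w: "w \<in> W" "w \<in> down X {m}"
    unfolding in_closure_of by metis
  then have "(w, m) \<in> ord X" by (simp add: down_iff)
  then have "(w, x) \<in> ord X" using m ord_trans by blast
  then show "x \<in> W"
    using W(1) w(1) by (auto simp: open_upset_iff)
next
  assume *: "\<forall>W. open_upset X W \<longrightarrow> F \<subseteq> cl X W \<longrightarrow> F \<subseteq> W"
  have "m \<in> localic_part X" if m: "m \<in> minimal X F" for m
  proof (rule ccontr)
    assume not_loc: "m \<notin> localic_part X"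
    have mF: "m \<in> F" "m \<in> points X"
      using m F(1) closedin_subset by (auto simp: minimal_def)
    define W where "W = points X - down X {m}"
    have closed: "closedin (topo X) (down X {m})"
      using mF(2) by (intro closed_down) (simp add: compactin_sing)
    have W: "open_upset X W"
      unfolding open_upset_iff W_def using closed
      by (auto simp: down_iff dest: ord_points ord_trans)
    have "m \<in> cl X W"
    proof (rule ccontr)
      assume "m \<notin> cl X W"
      then have "cl X W \<inter> down X {m} = {}"
        using upset_up[OF cl_upset] W by (auto simp: down_iff open_upset_def)
      then have "cl X W = W"
        using open_upset_subset_cl[OF W] closure_of_subset_topspace[of "topo X" W] by (auto simp: W_def)
      then have "closedin (topo X) W" by (metis closedin_closure_of)
      then have "openin (topo X) (points X - W)" by blast
      moreover have "points X - W = down X {m}" by (auto simp: W_def down_def)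
      ultimately show False
        using not_loc closed mF by (simp add: localic_part_def clopen_def)
    qed
    moreover have "x \<in> W" if "x \<in> F" "x \<noteq> m" for x
      using that m upset_subset[OF F(2)] by (auto simp: W_def down_iff minimal_def)
    ultimately have "F \<subseteq> cl X W"
      using open_upset_subset_cl[OF W] by blast
    then have "m \<in> W" using * W mF by blast
    then show False using ord_refl[OF mF(2)] by (simp add: W_def down_iff)
  qed
  then show "scott_upset X F" using F by (auto simp: scott_upset_def)
qed

lemma way_below_subset: "\<lbrakk>space_way_below X V U; U \<in> ClopUp X\<rbrakk> \<Longrightarrow> V \<subseteq> U"
  using ClopUpD(4) cl_ClopUp_eq unfolding space_way_below_def by blast

lemma way_below_mono:
  "\<lbrakk>space_way_below X V U; V' \<subseteq> V; U \<subseteq> U'\<rbrakk> \<Longrightarrow> space_way_below X V' U'"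
  unfolding space_way_below_def by blast

lemma way_below_empty: "space_way_below X {} U"
  by (simp add: space_way_below_def)

lemma way_below_Un:
  "\<lbrakk>space_way_below X V U; space_way_below X V' U'\<rbrakk> \<Longrightarrow> space_way_below X (V \<union> V') (U \<union> U')"
  unfolding space_way_below_def by simp

lemma ker_open_upset: "open_upset X (ker X U)"
  unfolding ker_def by (intro open_upset_Union) blast

lemma ker_subset: "U \<in> ClopUp X \<Longrightarrow> ker X U \<subseteq> U"
  unfolding ker_def using way_below_subset by blast

lemma dense_ker_iff:
  assumes U: "U \<in> ClopUp X"
  shows "subtopology (topo X) U closure_of ker X U = U \<longleftrightarrow> cl X (ker X U) = U"
proof -
  have "cl X (ker X U) \<subseteq> U"
    using ker_subset[OF U] ClopUpD(2)[OF U] by (rule closure_of_minimal)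
  then show ?thesis
    using ker_subset[OF U] by (simp add: closure_of_subtopology Int_absorb1)
qed

text \<open>
  The clopen upsets way below \<open>U\<close> are closed under binary unions, so a compact subset of their union lies
  in one of them.
\<close>
lemma compact_below_ker:
  assumes "compactin (topo X) F" "F \<subseteq> ker X U"
  shows "\<exists>V\<in>ClopUp X. F \<subseteq> V \<and> space_way_below X V U"
proof -
  have "\<exists>V\<in>{V \<in> ClopUp X. space_way_below X V U}. F \<subseteq> V"
  proof (rule finite_subcover_by_directed[OF assms(1)])
    show "V \<union> V' \<in> {V \<in> ClopUp X. space_way_below X V U}"
      if "V \<in> {V \<in> ClopUp X. space_way_below X V U}" "V' \<in> {V \<in> ClopUp X. space_way_below X V U}" for V V'
      using that way_below_Un[of V U V' U] by (simp add: ClopUp_lattice)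
  qed (use assms(2) in \<open>auto simp: ker_def way_below_empty ClopUp_lattice\<close>)
  then show ?thesis by auto
qed

end

locale cl_space = l_space +
  assumes cl_space: "CL_space X"
begin

lemma cl_ker: "U \<in> ClopUp X \<Longrightarrow> cl X (ker X U) = U"
  using cl_space dense_ker_iff by (simp add: CL_space_def)

text \<open>
  Applying density of kernels twice, \<open>U\<close> lies in the closure of the union of all \<open>V'\<close> with
  \<open>V' \<ll> U' \<ll> U\<close> for some \<open>U'\<close>. So \<open>V\<close> lies in that union, and by compactness in a single \<open>V'\<close>.
\<close>
lemma interpolation:
  assumes VU: "space_way_below X V U" and V: "V \<in> ClopUp X" and U: "U \<in> ClopUp X"
  shows "\<exists>U'\<in>ClopUp X. space_way_below X V U' \<and> space_way_below X U' U"
proof -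
  define \<K> where "\<K> = {V' \<in> ClopUp X. \<exists>U'\<in>ClopUp X. space_way_below X V' U' \<and> space_way_below X U' U}"
  have \<K>: "\<K> \<subseteq> ClopUp X" by (auto simp: \<K>_def)
  have "U' \<subseteq> cl X (\<Union>\<K>)" if "U' \<in> ClopUp X" "space_way_below X U' U" for U'
  proof -
    have "ker X U' \<subseteq> \<Union>\<K>"
      using that by (auto simp: ker_def \<K>_def)
    then have "cl X (ker X U') \<subseteq> cl X (\<Union>\<K>)" by (rule closure_of_mono)
    then show ?thesis using cl_ker[OF that(1)] by simp
  qed
  then have "ker X U \<subseteq> cl X (\<Union>\<K>)"
    by (auto simp: ker_def)
  then have "U \<subseteq> cl X (\<Union>\<K>)"
    using closure_of_minimal[of "ker X U" "cl X (\<Union>\<K>)" "topo X"] cl_ker[OF U] by simp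
  then have "V \<subseteq> \<Union>\<K>"
    using VU open_upset_Union[OF \<K>] unfolding space_way_below_def by blast
  then have "\<exists>V'\<in>\<K>. V \<subseteq> V'"
  proof (rule finite_subcover_by_directed[OF closed_compact[OF ClopUpD(2)[OF V]] _ \<K>])
    show "{} \<in> \<K>"
      using way_below_empty ClopUp_lattice(1) by (auto simp: \<K>_def)
    fix V1 V2 assume "V1 \<in> \<K>" "V2 \<in> \<K>"
    then obtain U1 U2 where "V1 \<in> ClopUp X" "V2 \<in> ClopUp X" "U1 \<in> ClopUp X" "U2 \<in> ClopUp X"
      "space_way_below X V1 U1" "space_way_below X V2 U2" "space_way_below X U1 U" "space_way_below X U2 U"
      by (auto simp: \<K>_def)
    then show "V1 \<union> V2 \<in> \<K>"
      using way_below_Un[of V1 U1 V2 U2] way_below_Un[of U1 U U2 U] ClopUp_lattice(4)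
      unfolding \<K>_def by auto
  qed
  then show ?thesis
    using way_below_mono unfolding \<K>_def by blast
qed

text \<open>
  Interpolating repeatedly gives \<open>V \<ll> \<dots> \<ll> C\<^sub>2 \<ll> C\<^sub>1 \<ll> C\<^sub>0 \<subseteq> U\<close>, and the intersection \<open>F\<close> of the \<open>C\<^sub>n\<close> is the
  required set: if \<open>F \<subseteq> cl W\<close>, then \<open>C\<^sub>n \<subseteq> cl W\<close> for some \<open>n\<close> by compactness, since \<open>cl W\<close> is open, and so
  \<open>F \<subseteq> C\<^sub>n\<^sub>+\<^sub>1 \<subseteq> W\<close>. In terms of the lattice this is the Scott-open filter generated by the \<open>C\<^sub>n\<close>.
\<close>
lemma scott_upset_between:
  assumes VU: "space_way_below X V U" and V: "V \<in> ClopUp X" and U: "U \<in> ClopUp X"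
  shows "\<exists>F. scott_upset X F \<and> V \<subseteq> F \<and> F \<subseteq> U"
proof -
  \<comment> \<open>the invariant \<open>V \<ll> C n\<close> is what allows the next interpolation\<close>
  have "\<exists>C. \<forall>n::nat. (C n \<in> ClopUp X \<and> space_way_below X V (C n) \<and> C n \<subseteq> U)
      \<and> space_way_below X (C (Suc n)) (C n)"
  proof (rule dependent_nat_choice)
    show "\<exists>C. C \<in> ClopUp X \<and> space_way_below X V C \<and> C \<subseteq> U"
      using assms by blast
    fix C :: "'a set" and n :: nat
    assume C: "C \<in> ClopUp X \<and> space_way_below X V C \<and> C \<subseteq> U"
    then obtain C' where C': "C' \<in> ClopUp X" "space_way_below X V C'" "space_way_below X C' C"
      using interpolation[OF _ V] by blast
    then show "\<exists>C'. (C' \<in> ClopUp X \<and> space_way_below X V C' \<and> C' \<subseteq> U) \<and> space_way_below X C' C"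
      using way_below_subset[OF C'(3)] C by (intro exI[of _ C']) auto
  qed
  then obtain C where C: "\<And>n::nat. C n \<in> ClopUp X" "\<And>n. space_way_below X V (C n)"
    "\<And>n. C n \<subseteq> U" "\<And>n. space_way_below X (C (Suc n)) (C n)"
    by blast
  have "C (Suc n) \<subseteq> C n" for n
    using way_below_subset[OF C(4) C(1)] .
  then have anti: "C n \<subseteq> C m" if "m \<le> n" for m n
    using that by (rule lift_Suc_antimono_le)
  define F where "F = (\<Inter>n. C n)"
  have F: "closedin (topo X) F" "upset X F"
  proof -
    show "closedin (topo X) F"
      unfolding F_def using ClopUpD(2)[OF C(1)] by (intro closedin_INT) auto
    then have "F \<subseteq> points X" by (rule closedin_subset)
    moreover have "y \<in> F" if "x \<in> F" "(x, y) \<in> ord X" for x y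
      using that upset_up[OF ClopUpD(3)[OF C(1)]] unfolding F_def by blast
    ultimately show "upset X F" by (simp add: upset_iff)
  qed
  have "F \<subseteq> W" if W: "open_upset X W" "F \<subseteq> cl X W" for W
  proof -
    \<comment> \<open>the whole space is added to the decreasing sequence only to have a filter base containing it\<close>
    have "\<exists>A\<in>insert (points X) (range C). \<exists>B\<in>{{}}. (points X - cl X W) \<inter> A \<subseteq> B"
    proof (rule compactin_cover_pair)
      show "compactin (topo X) (points X - cl X W)"
        using ClopUpD(1)[OF cl_ClopUp[OF W(1)]] by (intro closed_compact closedin_diff closedin_topspace)
      show "closedin (topo X) A" if "A \<in> insert (points X) (range C)" for A
        using that ClopUpD(2)[OF C(1)] by auto
      show "A \<inter> A' \<in> insert (points X) (range C)"
        if "A \<in> insert (points X) (range C)" "A' \<in> insert (points X) (range C)" for A A'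
      proof -
        have "C n \<inter> C m \<in> range C" for n m
          using anti[of n m] anti[of m n] by (cases "n \<le> m") (auto simp: Int_absorb1 Int_absorb2)
        then show ?thesis using that ClopUpD(5)[OF C(1)] by (auto simp: Int_absorb1 Int_absorb2)
      qed
      show "(\<exists>A\<in>insert (points X) (range C). y \<notin> A) \<or> (\<exists>B\<in>{{}}. y \<in> B)"
        if "y \<in> points X - cl X W" for y
        using that W(2) by (auto simp: F_def)
    qed auto
    then obtain n where n: "C n \<subseteq> cl X W"
      using ClopUpD(5)[OF C(1)] by auto
    then have "C (Suc n) \<subseteq> W"
      using C(4)[of n] W(1) by (auto simp: space_way_below_def)
    then show ?thesis by (auto simp: F_def)
  qed
  then have "scott_upset X F"
    using scott_upset_iff[OF F] by blast
  moreover have "V \<subseteq> F"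
    using way_below_subset[OF C(2) C(1)] by (auto simp: F_def)
  moreover have "F \<subseteq> U"
    using C(3) by (auto simp: F_def)
  ultimately show ?thesis by blast
qed

lemma scott_upset_compact_below:
  assumes "scott_upset X F" "U \<in> ClopUp X" "F \<subseteq> U"
  shows "\<exists>V\<in>ClopUp X. F \<subseteq> V \<and> space_way_below X V U"
proof (rule compact_below_ker)
  have F: "closedin (topo X) F" "upset X F" using assms(1) by (auto simp: scott_upset_def)
  then show "compactin (topo X) F" by (simp add: closed_compact)
  show "F \<subseteq> ker X U"
    using scott_upset_iff[OF F] assms ker_open_upset cl_ker by blast
qed

text \<open>
  From left to right, put Scott upsets \<open>F\<^sub>i\<close> between \<open>V\<close> and \<open>U\<^sub>i\<close>; then \<open>V \<subseteq> F\<^sub>1 \<inter> F\<^sub>2 \<subseteq> U\<^sub>1 \<inter> U\<^sub>2\<close>, and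
  \<open>V \<ll> U\<^sub>1 \<inter> U\<^sub>2\<close> because \<open>F\<^sub>1 \<inter> F\<^sub>2\<close> is a Scott upset. From right to left, let \<open>F \<inter> G \<subseteq> cl W\<close>. Separation
  gives clopen upsets \<open>A\<close> and \<open>B\<close> around \<open>F\<close> and \<open>G\<close> with \<open>A \<inter> B \<subseteq> cl W\<close>. Since \<open>F\<close> and \<open>G\<close> are Scott upsets,
  they are still contained in some \<open>A' \<ll> A\<close> and \<open>B' \<ll> B\<close>, and by stability \<open>F \<inter> G \<subseteq> A' \<inter> B' \<subseteq> W\<close>.
\<close>
lemma scott_stable_iff:
  "scott_stable X \<longleftrightarrow> (\<forall>V\<in>ClopUp X. \<forall>U1\<in>ClopUp X. \<forall>U2\<in>ClopUp X.
     space_way_below X V U1 \<and> space_way_below X V U2 \<longrightarrow> space_way_below X V (U1 \<inter> U2))"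
proof (intro iffI ballI impI)
  fix V U1 U2 assume *: "scott_stable X" "V \<in> ClopUp X" "U1 \<in> ClopUp X" "U2 \<in> ClopUp X"
    "space_way_below X V U1 \<and> space_way_below X V U2"
  obtain F1 where F1: "scott_upset X F1" "V \<subseteq> F1" "F1 \<subseteq> U1"
    using scott_upset_between * by blast
  obtain F2 where F2: "scott_upset X F2" "V \<subseteq> F2" "F2 \<subseteq> U2"
    using scott_upset_between * by blast
  have scott: "scott_upset X (F1 \<inter> F2)"
    using *(1) F1(1) F2(1) by (simp add: scott_stable_def)
  then have F: "closedin (topo X) (F1 \<inter> F2)" "upset X (F1 \<inter> F2)"
    by (auto simp: scott_upset_def)
  show "space_way_below X V (U1 \<inter> U2)"
    unfolding space_way_below_def
  proof (intro allI impI)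
    fix W assume W: "open_upset X W" "U1 \<inter> U2 \<subseteq> cl X W"
    then have "F1 \<inter> F2 \<subseteq> W"
      using scott scott_upset_iff[OF F] F1(3) F2(3) by blast
    then show "V \<subseteq> W" using F1(2) F2(2) by blast
  qed
next
  assume stable: "\<forall>V\<in>ClopUp X. \<forall>U1\<in>ClopUp X. \<forall>U2\<in>ClopUp X.
     space_way_below X V U1 \<and> space_way_below X V U2 \<longrightarrow> space_way_below X V (U1 \<inter> U2)"
  have "scott_upset X (F \<inter> G)" if F: "scott_upset X F" and G: "scott_upset X G" for F G
  proof -
    have F': "closedin (topo X) F" "upset X F" and G': "closedin (topo X) G" "upset X G"
      using F G by (auto simp: scott_upset_def)
    have FG: "closedin (topo X) (F \<inter> G)" "upset X (F \<inter> G)"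
      using F' G' by (auto simp: upset_iff)
    have "F \<inter> G \<subseteq> W" if W: "open_upset X W" "F \<inter> G \<subseteq> cl X W" for W
    proof -
      obtain A B where AB: "A \<in> ClopUp X" "B \<in> ClopUp X" "F \<subseteq> A" "G \<subseteq> B" "A \<inter> B \<subseteq> cl X W"
        using closed_upsets_meet_below_open[OF F' G' ClopUpD(1)[OF cl_ClopUp[OF W(1)]] W(2)]
        by (elim bexE conjE)
      obtain A' where A': "A' \<in> ClopUp X" "F \<subseteq> A'" "space_way_below X A' A"
        using scott_upset_compact_below[OF F AB(1,3)] by (elim bexE conjE)
      obtain B' where B': "B' \<in> ClopUp X" "G \<subseteq> B'" "space_way_below X B' B"
        using scott_upset_compact_below[OF G AB(2,4)] by (elim bexE conjE)
      have "space_way_below X (A' \<inter> B') A" "space_way_below X (A' \<inter> B') B"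
        by (rule way_below_mono[OF A'(3)]; simp) (rule way_below_mono[OF B'(3)]; simp)
      then have "space_way_below X (A' \<inter> B') (A \<inter> B)"
        using stable AB(1,2) ClopUp_lattice(3)[OF A'(1) B'(1)] by simp
      then have "A' \<inter> B' \<subseteq> W"
        using W(1) AB(5) by (simp add: space_way_below_def)
      then show ?thesis using A'(2) B'(2) by auto
    qed
    then show ?thesis
      using scott_upset_iff[OF FG] by simp
  qed
  then show "scott_stable X" by (simp add: scott_stable_def)
qed

end

section \<open>Frames represented by clopen upsets\<close>

definition represents :: "'a gorder \<Rightarrow> ('a \<Rightarrow> 'p set) \<Rightarrow> 'p ordered_space \<Rightarrow> bool" where
  "represents L \<phi> X \<longleftrightarrow> partial_order L \<and> priestley_space X \<and>
     bij_betw \<phi> (carrier L) (ClopUp X) \<and>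
     (\<forall>a\<in>carrier L. \<forall>b\<in>carrier L. a \<sqsubseteq>\<^bsub>L\<^esub> b \<longleftrightarrow> \<phi> a \<subseteq> \<phi> b)"

locale representation = partial_order L + priestley X
  for L :: "'a gorder" (structure) and X :: "'p ordered_space" +
  fixes \<phi> :: "'a \<Rightarrow> 'p set"
  assumes bij: "bij_betw \<phi> (carrier L) (ClopUp X)"
    and le_iff: "\<lbrakk>a \<in> carrier L; b \<in> carrier L\<rbrakk> \<Longrightarrow> a \<sqsubseteq> b \<longleftrightarrow> \<phi> a \<subseteq> \<phi> b"

lemma represents_iff: "represents L \<phi> X \<longleftrightarrow> representation L X \<phi>"
  by (auto simp: represents_def representation_def representation_axioms_def priestley_def)

context representation
begin

lemma \<phi>_ClopUp: "a \<in> carrier L \<Longrightarrow> \<phi> a \<in> ClopUp X"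
  using bij by (auto simp: bij_betw_def)

lemma ClopUp_eq: "ClopUp X = \<phi> ` carrier L"
  using bij by (simp add: bij_betw_def)

lemma \<phi>_surj: "U \<in> ClopUp X \<Longrightarrow> \<exists>a\<in>carrier L. \<phi> a = U"
  unfolding ClopUp_eq by (elim imageE) auto

lemma \<phi>_inj: "\<lbrakk>a \<in> carrier L; b \<in> carrier L; \<phi> a = \<phi> b\<rbrakk> \<Longrightarrow> a = b"
  using bij by (auto simp: bij_betw_def inj_on_def)

lemma \<phi>_image: "S \<subseteq> carrier L \<Longrightarrow> \<phi> ` S \<subseteq> ClopUp X"
  using \<phi>_ClopUp by blast

lemma open_upset_eq_\<phi>:
  "open_upset X W \<Longrightarrow> W = \<Union>(\<phi> ` {c \<in> carrier L. \<phi> c \<subseteq> W})"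
proof -
  assume "open_upset X W"
  then have "W = \<Union>{U \<in> ClopUp X. U \<subseteq> W}" by (rule open_upset_eq_Union)
  moreover have "{U \<in> ClopUp X. U \<subseteq> W} = \<phi> ` {c \<in> carrier L. \<phi> c \<subseteq> W}"
    using \<phi>_surj \<phi>_ClopUp by (auto simp: image_iff) metis
  ultimately show ?thesis by simp
qed

end

lemma is_frame_complete: "is_frame L \<Longrightarrow> complete_lattice L"
  unfolding is_frame_def by (rule conjunct1)

text \<open>
  The common ground of the two implications between the frame law and the L-space property: each of
  them yields these two conditions, and the conditions suffice to compute joins.
\<close>
locale complete_representation = representation +
  assumes complete: "complete_lattice L" and esakia: "esakia_space X"
begin

sublocale complete_lattice L
  by (rule complete)

text \<open>
  The closure of an open upset is a closed upset, hence the intersection of the clopen upsets around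
  it; so it is the least clopen upset containing the union as soon as there is a least one.
\<close>
lemma \<phi>_sup:
  assumes S: "S \<subseteq> carrier L"
  shows "\<phi> (\<Squnion>S) = cl X (\<Union>(\<phi> ` S))"
proof (rule equalityI)
  let ?W = "\<Union>(\<phi> ` S)"
  have W: "open_upset X ?W" using \<phi>_image[OF S] by (rule open_upset_Union)
  have sup: "\<Squnion>S \<in> carrier L" using S by simp
  have "?W \<subseteq> \<phi> (\<Squnion>S)"
    using S sup_upper[OF S] le_iff[OF _ sup] by blast
  then show "cl X ?W \<subseteq> \<phi> (\<Squnion>S)"
    using ClopUpD(2)[OF \<phi>_ClopUp[OF sup]] by (rule closure_of_minimal)
  have cl: "closedin (topo X) (cl X ?W)" "upset X (cl X ?W)"
    using closure_upset[OF esakia] W by (auto simp: open_upset_def)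
  have WX: "?W \<subseteq> points X" using W openin_subset by (auto simp: open_upset_def)
  show "\<phi> (\<Squnion>S) \<subseteq> cl X ?W"
  proof
    fix x assume x: "x \<in> \<phi> (\<Squnion>S)"
    show "x \<in> cl X ?W"
    proof (rule ccontr)
      assume not: "x \<notin> cl X ?W"
      have xX: "x \<in> points X" using x ClopUpD(5)[OF \<phi>_ClopUp[OF sup]] by blast
      have "\<exists>U\<in>ClopUp X. cl X ?W \<subseteq> U \<and> U \<inter> {x} = {}"
      proof (rule separate_by_ClopUp)
        show "compactin (topo X) (cl X ?W)" using cl(1) by (rule closed_compact)
        show "compactin (topo X) {x}" using xX by (simp add: compactin_sing)
        show "(w, y) \<notin> ord X" if "w \<in> cl X ?W" "y \<in> {x}" for w y
          using that upset_up[OF cl(2)] not by auto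
      qed
      then obtain U where U: "U \<in> ClopUp X" "cl X ?W \<subseteq> U" "x \<notin> U" by auto
      obtain u where u: "u \<in> carrier L" "\<phi> u = U" using \<phi>_surj[OF U(1)] by auto
      have "?W \<subseteq> U" using U(2) closure_of_subset[OF WX] by simp
      then have "\<Squnion>S \<sqsubseteq> u"
        using \<open>?W \<subseteq> U\<close> u subsetD[OF S] by (intro sup_least[OF S u(1)]) (auto simp: le_iff)
      then show False using le_iff[OF sup u(1)] u(2) U(3) x by auto
    qed
  qed
qed

lemma \<phi>_sup_finite:
  assumes S: "S \<subseteq> carrier L" "finite S"
  shows "\<phi> (\<Squnion>S) = \<Union>(\<phi> ` S)"
proof -
  have "\<Union>(\<phi> ` S) \<in> ClopUp X"
    using ClopUp_Union[OF _ \<phi>_image[OF S(1)]] S(2) by simp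
  then show ?thesis
    using \<phi>_sup[OF S(1)] by (simp add: ClopUpD closure_of_closedin)
qed

lemma \<phi>_inf_finite:
  assumes S: "S \<subseteq> carrier L" "finite S"
  shows "\<phi> (\<Sqinter>S) = points X \<inter> \<Inter>(\<phi> ` S)"
proof (rule equalityI)
  have inf: "\<Sqinter>S \<in> carrier L" using S by simp
  show "\<phi> (\<Sqinter>S) \<subseteq> points X \<inter> \<Inter>(\<phi> ` S)"
    using S(1) inf_lower[OF S(1)] le_iff[OF inf] ClopUpD(5)[OF \<phi>_ClopUp[OF inf]] by blast
  have "points X \<inter> \<Inter>(\<phi> ` S) \<in> ClopUp X"
    using ClopUp_Inter[OF _ \<phi>_image[OF S(1)]] S(2) by simp
  then obtain c where c: "c \<in> carrier L" "\<phi> c = points X \<inter> \<Inter>(\<phi> ` S)"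
    using \<phi>_surj by metis
  then have "c \<sqsubseteq> \<Sqinter>S"
    using subsetD[OF S(1)] by (intro inf_greatest[OF S(1) c(1)]) (auto simp: le_iff)
  then show "points X \<inter> \<Inter>(\<phi> ` S) \<subseteq> \<phi> (\<Sqinter>S)"
    using le_iff[OF c(1) inf] c(2) by simp
qed

lemma \<phi>_meet: "\<lbrakk>a \<in> carrier L; b \<in> carrier L\<rbrakk> \<Longrightarrow> \<phi> (a \<sqinter> b) = \<phi> a \<inter> \<phi> b"
  using \<phi>_inf_finite[of "{a, b}"] ClopUpD(5)[OF \<phi>_ClopUp] by (auto simp: meet_def)

lemma \<phi>_top: "\<phi> \<top> = points X"
proof -
  obtain t where "t \<in> carrier L" "\<phi> t = points X"
    using \<phi>_surj ClopUp_lattice(2) by auto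
  then show ?thesis
    using le_iff[of t "\<top>"] ClopUpD(5)[OF \<phi>_ClopUp[of "\<top>"]] top_higher by auto
qed

lemma L_space: "L_space X"
proof -
  have "openin (topo X) (cl X W)" if W: "open_upset X W" for W
  proof -
    let ?S = "{c \<in> carrier L. \<phi> c \<subseteq> W}"
    have "cl X W = \<phi> (\<Squnion>?S)"
      using \<phi>_sup[of ?S] open_upset_eq_\<phi>[OF W] by auto
    then show ?thesis
      using ClopUpD(1)[OF \<phi>_ClopUp[of "\<Squnion>?S"]] by simp
  qed
  then show ?thesis using esakia by (simp add: L_space_def)
qed

end

context representation
begin

text \<open>
  With \<open>c\<close> the Heyting implication from \<open>a\<close> to \<open>b\<close>, the complement of the down-set of \<open>\<phi> a - \<phi> b\<close> is \<open>\<phi> c\<close>: it is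
  an open upset, and a clopen upset \<open>W\<close> is contained in it iff \<open>W \<inter> \<phi> a \<subseteq> \<phi> b\<close>. The frame law is what makes \<open>c\<close>,
  the join of all such \<open>W\<close>, one of them.
\<close>
lemma esakia_if_frame:
  assumes "is_frame L"
  shows "esakia_space X"
proof (rule esakiaI)
  interpret complete_lattice L using assms by (rule is_frame_complete)
  have meet_sub: "\<phi> (a \<sqinter> b) = \<phi> a \<inter> \<phi> b" if ab0: "a \<in> carrier L" "b \<in> carrier L" for a b
  proof (rule equalityI)
    have ab: "a \<sqinter> b \<in> carrier L" using ab0 by simp
    show "\<phi> (a \<sqinter> b) \<subseteq> \<phi> a \<inter> \<phi> b"
      using ab0 meet_left[OF ab0] meet_right[OF ab0] by (simp add: le_iff)
    obtain c where "c \<in> carrier L" "\<phi> c = \<phi> a \<inter> \<phi> b"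
      using \<phi>_surj[OF ClopUp_lattice(3)[OF \<phi>_ClopUp[OF ab0(1)] \<phi>_ClopUp[OF ab0(2)]]] by auto
    then show "\<phi> a \<inter> \<phi> b \<subseteq> \<phi> (a \<sqinter> b)"
      using ab0 meet_le[of c a b] le_iff[of c "a \<sqinter> b"] by (simp add: le_iff)
  qed
  fix U V assume UV: "U \<in> ClopUp X" "V \<in> ClopUp X"
  then obtain a b where ab: "a \<in> carrier L" "\<phi> a = U" "b \<in> carrier L" "\<phi> b = V"
    using \<phi>_surj by metis
  \<comment> \<open>the Heyting implication from \<open>a\<close> to \<open>b\<close>\<close>
  define S where "S = {c \<in> carrier L. a \<sqinter> c \<sqsubseteq> b}"
  have S: "S \<subseteq> carrier L" by (auto simp: S_def)
  have "a \<sqinter> \<Squnion>S = \<Squnion>((\<lambda>s. a \<sqinter> s) ` S)"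
    using assms ab(1) S by (simp add: is_frame_def)
  also have "\<dots> \<sqsubseteq> b"
    using ab S by (intro sup_least) (auto simp: S_def)
  finally have "\<phi> (\<Squnion>S) \<inter> U \<subseteq> V"
    using ab S meet_sub[of a "\<Squnion>S"] by (auto simp: le_iff)
  moreover have supS: "\<phi> (\<Squnion>S) \<in> ClopUp X" using S by (simp add: \<phi>_ClopUp)
  ultimately have "down X (U - V) \<subseteq> points X - \<phi> (\<Squnion>S)"
    using upset_up[OF ClopUpD(3)[OF supS]] ord_points unfolding down_def by blast
  moreover have "x \<in> down X (U - V)" if x: "x \<in> points X - \<phi> (\<Squnion>S)" for x
  proof (rule ccontr)
    assume not: "x \<notin> down X (U - V)"
    have "\<exists>W\<in>ClopUp X. {x} \<subseteq> W \<and> W \<inter> (U - V) = {}"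
    proof (rule separate_by_ClopUp)
      show "compactin (topo X) {x}" using x by (simp add: compactin_sing)
      show "compactin (topo X) (U - V)"
        using UV by (intro closed_compact closedin_diff ClopUpD)
      show "(y, z) \<notin> ord X" if "y \<in> {x}" "z \<in> U - V" for y z
        using that not by (auto simp: down_iff)
    qed
    then obtain W where W: "W \<in> ClopUp X" "x \<in> W" "W \<inter> (U - V) = {}" by auto
    then obtain c where c: "c \<in> carrier L" "\<phi> c = W" using \<phi>_surj by metis
    have "\<phi> (a \<sqinter> c) \<subseteq> \<phi> b"
      unfolding meet_sub[OF ab(1) c(1)] c(2) ab(2,4) using W(3) by blast
    then have "c \<in> S"
      using ab(1,3) c(1) le_iff[of "a \<sqinter> c" b] by (simp add: S_def)
    then have "c \<sqsubseteq> \<Squnion>S" by (rule sup_upper[OF S])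
    then show False using c x W(2) S by (auto simp: le_iff)
  qed
  ultimately have "down X (U - V) = points X - \<phi> (\<Squnion>S)" by blast
  then show "openin (topo X) (down X (U - V))"
    using ClopUpD(2)[OF supS] by (simp add: openin_diff)
qed

text \<open>
  Closures of unions are clopen upsets, hence joins, and meets are joins of lower bounds. The frame law
  is \<open>U \<inter> cl W = cl (U \<inter> W)\<close>, valid because \<open>U\<close> is both open and closed.
\<close>
lemma frame_if_L_space:
  assumes "L_space X"
  shows "is_frame L"
proof -
  interpret l_space X by unfold_locales (rule assms)
  have complete: "complete_lattice L"
  proof (rule complete_latticeI)
    fix A assume A: "A \<subseteq> carrier L"
    obtain s where s: "s \<in> carrier L" "\<phi> s = cl X (\<Union>(\<phi> ` A))"
      using \<phi>_surj[OF cl_ClopUp[OF open_upset_Union[OF \<phi>_image[OF A]]]] by auto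
    have "\<Union>(\<phi> ` A) \<subseteq> \<phi> s"
      using open_upset_subset_cl[OF open_upset_Union[OF \<phi>_image[OF A]]] s(2) by simp
    moreover have "\<phi> s \<subseteq> \<phi> u" if "u \<in> carrier L" "\<Union>(\<phi> ` A) \<subseteq> \<phi> u" for u
      using closure_of_minimal[OF that(2) ClopUpD(2)[OF \<phi>_ClopUp[OF that(1)]]] s(2) by simp
    moreover have "u \<in> Upper L A \<longleftrightarrow> u \<in> carrier L \<and> \<Union>(\<phi> ` A) \<subseteq> \<phi> u" for u
      unfolding Upper_def UN_subset_iff using subsetD[OF A] le_iff[of _ u] by blast
    ultimately have "least L s (Upper L A)"
      using s(1) Upper_closed[of L A] unfolding least_def by (simp add: le_iff)
    then show "\<exists>s. least L s (Upper L A)" ..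
    define B where "B = {b \<in> carrier L. \<forall>a\<in>A. \<phi> b \<subseteq> \<phi> a}"
    have B: "B \<subseteq> carrier L" by (auto simp: B_def)
    obtain i where i: "i \<in> carrier L" "\<phi> i = cl X (\<Union>(\<phi> ` B))"
      using \<phi>_surj[OF cl_ClopUp[OF open_upset_Union[OF \<phi>_image[OF B]]]] by auto
    have "\<phi> b \<subseteq> \<phi> i" if "b \<in> B" for b
      using open_upset_subset_cl[OF open_upset_Union[OF \<phi>_image[OF B]]] i(2) that by auto
    moreover have "\<phi> i \<subseteq> \<phi> a" if "a \<in> A" for a
      using closure_of_minimal[of "\<Union>(\<phi> ` B)" "\<phi> a" "topo X"] ClopUpD(2)[OF \<phi>_ClopUp[of a]] that A i(2)
      by (auto simp: B_def)
    moreover have "Lower L A = B"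
      unfolding Lower_def B_def using subsetD[OF A] le_iff by blast
    ultimately have "greatest L i (Lower L A)"
      using i(1) B le_iff[OF _ i(1)] unfolding greatest_def by (auto simp: B_def)
    then show "\<exists>i. greatest L i (Lower L A)" ..
  qed
  interpret complete_representation L X \<phi>
    using assms complete representation_axioms
    by (simp add: complete_representation_def complete_representation_axioms_def L_space_def)
  have "a \<sqinter> \<Squnion>S = \<Squnion>((\<lambda>s. a \<sqinter> s) ` S)" if a: "a \<in> carrier L" and S: "S \<subseteq> carrier L" for a S
  proof (rule \<phi>_inj)
    have aS: "(\<lambda>s. a \<sqinter> s) ` S \<subseteq> carrier L" using a S by auto
    have "(\<Union>(\<phi> ` (\<lambda>s. a \<sqinter> s) ` S)) = \<phi> a \<inter> \<Union>(\<phi> ` S)"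
      using a S by (auto simp: \<phi>_meet subset_iff)
    then have "\<phi> (\<Squnion>((\<lambda>s. a \<sqinter> s) ` S)) = cl X (\<phi> a \<inter> \<Union>(\<phi> ` S))"
      using \<phi>_sup[OF aS] by simp
    also have "\<dots> = cl X (\<phi> a \<inter> cl X (\<Union>(\<phi> ` S)))"
      using closure_of_openin_Int_closure_of[OF ClopUpD(1)[OF \<phi>_ClopUp[OF a]]] by simp
    also have "\<dots> = \<phi> (a \<sqinter> \<Squnion>S)"
      using \<phi>_sup[OF S] a S \<phi>_ClopUp[of "a \<sqinter> \<Squnion>S"] by (simp add: \<phi>_meet cl_ClopUp_eq)
    finally show "\<phi> (a \<sqinter> \<Squnion>S) = \<phi> (\<Squnion>((\<lambda>s. a \<sqinter> s) ` S))" by simp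
    show "\<Squnion>((\<lambda>s. a \<sqinter> s) ` S) \<in> carrier L" using aS by (rule sup_closed)
  qed (use a S in simp)
  then show ?thesis using complete by (simp add: is_frame_def)
qed

lemma is_frame_iff: "is_frame L \<longleftrightarrow> L_space X"
proof
  assume "is_frame L"
  then interpret complete_representation L X \<phi>
    using esakia_if_frame is_frame_complete representation_axioms
    by (simp add: complete_representation_def complete_representation_axioms_def)
  show "L_space X" by (rule L_space)
qed (rule frame_if_L_space)

end

locale frame_representation = representation +
  assumes frame: "is_frame L"
begin

sublocale complete_representation
  using frame esakia_if_frame is_frame_complete representation_axioms
  by (simp add: complete_representation_def complete_representation_axioms_def)

sublocale l_space X
  using L_space by unfold_locales

text \<open>
  The images of the members of a subset of \<open>L\<close> have an open upset \<open>W\<close> as their union, every open upset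
  arises so, and the join is represented by \<open>cl W\<close>. That \<open>a\<close> is below the join of a finite part means
  \<open>\<phi> a \<subseteq> W\<close>, by compactness of \<open>\<phi> a\<close>.
\<close>
lemma way_below_iff:
  assumes ab: "a \<in> carrier L" "b \<in> carrier L"
  shows "way_below L a b \<longleftrightarrow> space_way_below X (\<phi> a) (\<phi> b)"
proof
  assume wb: "way_below L a b"
  show "space_way_below X (\<phi> a) (\<phi> b)"
    unfolding space_way_below_def
  proof (intro allI impI)
    fix W assume W: "open_upset X W" "\<phi> b \<subseteq> cl X W"
    define S where "S = {c \<in> carrier L. \<phi> c \<subseteq> W}"
    have S: "S \<subseteq> carrier L" "W = \<Union>(\<phi> ` S)"
      using open_upset_eq_\<phi>[OF W(1)] by (auto simp: S_def)
    then have "b \<sqsubseteq> \<Squnion>S"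
      using W(2) ab by (simp add: le_iff \<phi>_sup)
    then obtain T where T: "T \<subseteq> S" "finite T" "a \<sqsubseteq> \<Squnion>T"
      using wb S(1) unfolding way_below_def by metis
    then have "\<phi> a \<subseteq> \<Union>(\<phi> ` T)"
      using ab S(1) le_iff[of a "\<Squnion>T"] \<phi>_sup_finite[of T] by auto
    then show "\<phi> a \<subseteq> W" using T(1) S(2) by blast
  qed
next
  assume wb: "space_way_below X (\<phi> a) (\<phi> b)"
  show "way_below L a b"
    unfolding way_below_def
  proof (intro conjI allI impI ab)
    fix S assume S: "S \<subseteq> carrier L" "b \<sqsubseteq> \<Squnion>S"
    then have "\<phi> b \<subseteq> cl X (\<Union>(\<phi> ` S))"
      using ab le_iff[of b "\<Squnion>S"] \<phi>_sup by simp
    then have sub: "\<phi> a \<subseteq> \<Union>(\<phi> ` S)"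
      using wb open_upset_Union[OF \<phi>_image[OF S(1)]] by (simp add: space_way_below_def)
    have "openin (topo X) U" if "U \<in> \<phi> ` S" for U
      using ClopUpD(1)[OF subsetD[OF \<phi>_image[OF S(1)] that]] .
    then obtain \<F> where \<F>: "finite \<F>" "\<F> \<subseteq> \<phi> ` S" "\<phi> a \<subseteq> \<Union>\<F>"
      using compactinD[OF closed_compact[OF ClopUpD(2)[OF \<phi>_ClopUp[OF ab(1)]]] _ sub]
      by metis
    then obtain T where T: "T \<subseteq> S" "finite T" "\<F> = \<phi> ` T"
      using finite_subset_image[OF \<F>(1,2)] by auto
    have "a \<sqsubseteq> \<Squnion>T"
      using T \<F>(3) S(1) ab le_iff[of a "\<Squnion>T"] \<phi>_sup_finite[of T] by auto
    then show "\<exists>T\<subseteq>S. finite T \<and> a \<sqsubseteq> \<Squnion>T" using T by blast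
  qed
qed

lemma compact_iff: "compact_frame L \<longleftrightarrow> L_compact X"
proof -
  have X: "closedin (topo X) (points X)" "upset X (points X)"
    using ClopUpD[OF ClopUp_lattice(2)] by auto
  have "compact_frame L \<longleftrightarrow> space_way_below X (points X) (points X)"
    using frame by (simp add: compact_frame_def way_below_iff \<phi>_top)
  also have "\<dots> \<longleftrightarrow> L_compact X"
    by (simp add: L_compact_def scott_upset_iff[OF X] space_way_below_def)
  finally show ?thesis .
qed

lemma ker_\<phi>:
  assumes "a \<in> carrier L"
  shows "ker X (\<phi> a) = \<Union>(\<phi> ` {b \<in> carrier L. way_below L b a})"
proof -
  have "{V \<in> ClopUp X. space_way_below X V (\<phi> a)} = \<phi> ` {b \<in> carrier L. way_below L b a}"
    unfolding ClopUp_eq using assms by (auto simp: way_below_iff)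
  then show ?thesis by (simp add: ker_def)
qed

lemma continuous_iff: "continuous_frame L \<longleftrightarrow> CL_space X"
proof -
  have "a = \<Squnion>{b \<in> carrier L. way_below L b a} \<longleftrightarrow>
      subtopology (topo X) (\<phi> a) closure_of ker X (\<phi> a) = \<phi> a" if a: "a \<in> carrier L" for a
  proof -
    let ?S = "{b \<in> carrier L. way_below L b a}"
    have S: "?S \<subseteq> carrier L" by auto
    have "a = \<Squnion>?S \<longleftrightarrow> \<phi> a = \<phi> (\<Squnion>?S)"
      using \<phi>_inj[OF a sup_closed[OF S]] by auto
    then show ?thesis
      using dense_ker_iff[OF \<phi>_ClopUp[OF a]] \<phi>_sup[OF S] ker_\<phi>[OF a] by auto
  qed
  then have "continuous_frame L \<longleftrightarrow>
      (\<forall>a\<in>carrier L. subtopology (topo X) (\<phi> a) closure_of ker X (\<phi> a) = \<phi> a)"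
    using frame by (simp add: continuous_frame_def)
  also have "\<dots> \<longleftrightarrow> (\<forall>U\<in>ClopUp X. subtopology (topo X) U closure_of ker X U = U)"
    by (simp add: ClopUp_eq)
  finally show ?thesis using L_space by (simp add: CL_space_def)
qed

lemma stable_iff:
  assumes "CL_space X"
  shows "way_below_stable L \<longleftrightarrow> scott_stable X"
proof -
  interpret cl_space X by unfold_locales (rule assms)
  show ?thesis
    unfolding way_below_stable_def scott_stable_iff ClopUp_eq ball_simps
    by (simp add: way_below_iff \<phi>_meet)
qed

end

lemma (in representation) stably_compact_iff: "stably_compact_frame L \<longleftrightarrow> StKL_space X"
proof (cases "is_frame L")
  case True
  then interpret frame_representation L X \<phi> by unfold_locales
  show ?thesis
    using stable_iff by (auto simp: stably_compact_frame_def stably_continuous_frame_def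
        StKL_space_def StCL_space_def compact_iff continuous_iff)
next
  case False
  then show ?thesis
    using is_frame_iff by (auto simp: stably_compact_frame_def compact_frame_def
        StKL_space_def StCL_space_def CL_space_def)
qed

section \<open>Frame homomorphisms and L-morphisms\<close>

lemma L_morphism_funcset: "L_morphism X Y f \<Longrightarrow> f \<in> points X \<rightarrow> points Y"
  by (simp add: L_morphism_def continuous_map_def)

lemma preimage_open_upset:
  assumes "priestley_space X" "priestley_space Y" and f: "L_morphism X Y f" and W: "open_upset Y W"
  shows "open_upset X (preimage X f W)"
proof -
  interpret dom: priestley X by unfold_locales (rule assms)
  interpret cod: priestley Y by unfold_locales (rule assms)
  have "openin (topo X) (preimage X f W)"
    using f W openin_continuous_map_preimage[of "topo X" "topo Y" f W]
    by (simp add: preimage_def L_morphism_def open_upset_def)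
  moreover have "f y \<in> W" if "f x \<in> W" "(x, y) \<in> ord X" for x y
    using that f W by (auto simp: L_morphism_def cod.open_upset_iff)
  ultimately show ?thesis
    using dom.ord_points by (auto simp: dom.open_upset_iff preimage_def)
qed

lemma preimage_ClopUp:
  assumes "priestley_space X" "priestley_space Y" and f: "L_morphism X Y f" and U: "U \<in> ClopUp Y"
  shows "preimage X f U \<in> ClopUp X"
proof -
  have "closedin (topo X) (preimage X f U)"
    using f ClopUpD(2)[OF U] closedin_continuous_map_preimage[of "topo X" "topo Y" f U]
    by (simp add: preimage_def L_morphism_def)
  then show ?thesis
    using preimage_open_upset[OF assms(1-3) ClopUpD(4)[OF U]]
    by (simp add: ClopUp_def clopen_def open_upset_def)
qed

text \<open>
  For spaces of prime filters this says that \<open>f\<close> maps a prime filter \<open>y\<close> to its preimage under \<open>h\<close>.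
\<close>
definition dual_maps ::
  "'a gorder \<Rightarrow> ('a \<Rightarrow> 'p set) \<Rightarrow> ('b \<Rightarrow> 'q set) \<Rightarrow> 'q ordered_space \<Rightarrow> ('a \<Rightarrow> 'b) \<Rightarrow> ('q \<Rightarrow> 'p) \<Rightarrow> bool" where
  "dual_maps L \<phi> \<psi> Y h f \<longleftrightarrow> (\<forall>a\<in>carrier L. preimage Y f (\<phi> a) = \<psi> (h a))"

locale representation_pair =
  dom: frame_representation L X \<phi> + cod: frame_representation M Y \<psi>
  for L :: "'a gorder" and X :: "'p ordered_space" and \<phi>
    and M :: "'b gorder" and Y :: "'q ordered_space" and \<psi>
begin

lemma preimage_Union: "preimage Y f (\<Union>\<K>) = \<Union>(preimage Y f ` \<K>)"
  by (auto simp: preimage_def)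

lemma dual_mapsD: "\<lbrakk>dual_maps L \<phi> \<psi> Y h f; a \<in> carrier L\<rbrakk> \<Longrightarrow> preimage Y f (\<phi> a) = \<psi> (h a)"
  by (simp add: dual_maps_def)

lemma dual_maps_Union:
  assumes "dual_maps L \<phi> \<psi> Y h f" "S \<subseteq> carrier L"
  shows "preimage Y f (\<Union>(\<phi> ` S)) = \<Union>(\<psi> ` h ` S)"
  unfolding preimage_Union image_image using assms by (intro SUP_cong) (auto simp: dual_maps_def)

lemma frame_hom_finite:
  assumes h: "frame_hom L M h" and S: "S \<subseteq> carrier L" "finite S"
  shows "\<psi> (h (\<Sqinter>\<^bsub>L\<^esub>S)) = points Y \<inter> \<Inter>(\<psi> ` h ` S)" "\<psi> (h (\<Squnion>\<^bsub>L\<^esub>S)) = \<Union>(\<psi> ` h ` S)"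
proof -
  have hS: "h ` S \<subseteq> carrier M" "finite (h ` S)"
    using h S by (auto simp: frame_hom_def)
  show "\<psi> (h (\<Sqinter>\<^bsub>L\<^esub>S)) = points Y \<inter> \<Inter>(\<psi> ` h ` S)"
    using h S cod.\<phi>_inf_finite[OF hS] by (simp add: frame_hom_def)
  show "\<psi> (h (\<Squnion>\<^bsub>L\<^esub>S)) = \<Union>(\<psi> ` h ` S)"
    using h S cod.\<phi>_sup_finite[OF hS] by (simp add: frame_hom_def)
qed

lemma frame_hom_mono:
  assumes h: "frame_hom L M h" and ab: "a \<in> carrier L" "b \<in> carrier L" "\<phi> a \<subseteq> \<phi> b"
  shows "\<psi> (h a) \<subseteq> \<psi> (h b)"
proof -
  have ab': "{a, b} \<subseteq> carrier L" "finite {a, b}" using ab by auto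
  have "\<phi> (\<Squnion>\<^bsub>L\<^esub>{a, b}) = \<phi> b"
    using dom.\<phi>_sup_finite[OF ab'] ab(3) by auto
  then have "\<Squnion>\<^bsub>L\<^esub>{a, b} = b"
    using dom.\<phi>_inj dom.sup_closed[OF ab'(1)] ab(2) by blast
  then show ?thesis
    using frame_hom_finite(2)[OF h ab'] by auto
qed

text \<open>
  The elements \<open>a\<close> with \<open>y \<in> \<psi> (h a)\<close> form a prime filter. In a represented lattice, such a filter is given
  by a point: otherwise compactness would yield \<open>a\<close> in the filter and \<open>b\<close> outside with \<open>\<phi> a \<subseteq> \<phi> b\<close>.
\<close>
lemma point_of_prime:
  assumes h: "frame_hom L M h" and y: "y \<in> points Y"
  shows "\<exists>x\<in>points X. \<forall>a\<in>carrier L. x \<in> \<phi> a \<longleftrightarrow> y \<in> \<psi> (h a)"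
proof (rule ccontr)
  assume no: "\<not> ?thesis"
  define \<P> where "\<P> = \<phi> ` {a \<in> carrier L. y \<in> \<psi> (h a)}"
  define \<N> where "\<N> = \<phi> ` {a \<in> carrier L. y \<notin> \<psi> (h a)}"
  have "\<exists>U\<in>\<P>. \<exists>V\<in>\<N>. points X \<inter> U \<subseteq> V"
  proof (rule compactin_cover_pair)
    show "compactin (topo X) (points X)"
      using dom.compact by (simp add: compact_space_def)
    show "closedin (topo X) U" if "U \<in> \<P>" for U
      using that ClopUpD(2)[OF dom.\<phi>_ClopUp] by (auto simp: \<P>_def)
    show "openin (topo X) V" if "V \<in> \<N>" for V
      using that ClopUpD(1)[OF dom.\<phi>_ClopUp] by (auto simp: \<N>_def)
    have "\<Sqinter>\<^bsub>L\<^esub>{} \<in> carrier L" "\<phi> (\<Sqinter>\<^bsub>L\<^esub>{}) = points X" "y \<in> \<psi> (h (\<Sqinter>\<^bsub>L\<^esub>{}))"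
      using dom.\<phi>_inf_finite[of "{}"] frame_hom_finite(1)[OF h, of "{}"] y by simp_all
    then show "points X \<in> \<P>" by (force simp: \<P>_def)
    have "\<Squnion>\<^bsub>L\<^esub>{} \<in> carrier L" "\<phi> (\<Squnion>\<^bsub>L\<^esub>{}) = {}" "y \<notin> \<psi> (h (\<Squnion>\<^bsub>L\<^esub>{}))"
      using dom.\<phi>_sup_finite[of "{}"] frame_hom_finite(2)[OF h, of "{}"] y by simp_all
    then show "{} \<in> \<N>" by (force simp: \<N>_def)
    show "U \<inter> U' \<in> \<P>" if UU': "U \<in> \<P>" "U' \<in> \<P>" for U U'
    proof -
      obtain a where a: "a \<in> carrier L" "U = \<phi> a" "y \<in> \<psi> (h a)"
        using UU'(1) by (auto simp: \<P>_def)
      obtain b where b: "b \<in> carrier L" "U' = \<phi> b" "y \<in> \<psi> (h b)"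
        using UU'(2) by (auto simp: \<P>_def)
      have ab: "{a, b} \<subseteq> carrier L" using a b by simp
      have "\<phi> (\<Sqinter>\<^bsub>L\<^esub>{a, b}) = U \<inter> U'"
        using dom.\<phi>_inf_finite[OF ab] a b ClopUpD(5)[OF dom.\<phi>_ClopUp[of a]] by auto
      moreover have "y \<in> \<psi> (h (\<Sqinter>\<^bsub>L\<^esub>{a, b}))"
        using frame_hom_finite(1)[OF h ab] a b y by simp
      ultimately show ?thesis
        using dom.inf_closed[OF ab] by (force simp: \<P>_def)
    qed
    show "V \<union> V' \<in> \<N>" if VV': "V \<in> \<N>" "V' \<in> \<N>" for V V'
    proof -
      obtain a where a: "a \<in> carrier L" "V = \<phi> a" "y \<notin> \<psi> (h a)"
        using VV'(1) by (auto simp: \<N>_def)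
      obtain b where b: "b \<in> carrier L" "V' = \<phi> b" "y \<notin> \<psi> (h b)"
        using VV'(2) by (auto simp: \<N>_def)
      have ab: "{a, b} \<subseteq> carrier L" using a b by simp
      have "\<phi> (\<Squnion>\<^bsub>L\<^esub>{a, b}) = V \<union> V'"
        using dom.\<phi>_sup_finite[OF ab] a b by auto
      moreover have "y \<notin> \<psi> (h (\<Squnion>\<^bsub>L\<^esub>{a, b}))"
        using frame_hom_finite(2)[OF h ab] a b by simp
      ultimately show ?thesis
        using dom.sup_closed[OF ab] by (force simp: \<N>_def)
    qed
    show "(\<exists>U\<in>\<P>. x \<notin> U) \<or> (\<exists>V\<in>\<N>. x \<in> V)" if "x \<in> points X" for x
      using no that unfolding \<P>_def \<N>_def by auto
  qed
  then obtain a b where ab: "a \<in> carrier L" "b \<in> carrier L" "y \<in> \<psi> (h a)" "y \<notin> \<psi> (h b)"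
      "points X \<inter> \<phi> a \<subseteq> \<phi> b"
    by (auto simp: \<P>_def \<N>_def)
  then have "\<phi> a \<subseteq> \<phi> b"
    using ClopUpD(5)[OF dom.\<phi>_ClopUp[of a]] by auto
  then show False
    using frame_hom_mono[OF h ab(1,2)] ab(3,4) by blast
qed

lemma dual_map_exists:
  assumes h: "frame_hom L M h"
  shows "\<exists>f\<in>extensional (points Y). f \<in> points Y \<rightarrow> points X \<and> dual_maps L \<phi> \<psi> Y h f"
proof -
  obtain g where g: "\<And>y. y \<in> points Y \<Longrightarrow> g y \<in> points X \<and> (\<forall>a\<in>carrier L. g y \<in> \<phi> a \<longleftrightarrow> y \<in> \<psi> (h a))"
    using point_of_prime[OF h] by metis
  have "\<psi> (h a) \<subseteq> points Y" if "a \<in> carrier L" for a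
    using h that ClopUpD(5)[OF cod.\<phi>_ClopUp[of "h a"]] by (auto simp: frame_hom_def)
  then have "dual_maps L \<phi> \<psi> Y h (restrict g (points Y))"
    using g unfolding dual_maps_def preimage_def by auto
  then show ?thesis
    using g by (intro bexI[of _ "restrict g (points Y)"]) auto
qed

text \<open>
  Continuity and monotonicity only need that \<open>f\<close> pulls clopen upsets back to clopen upsets; compatibility
  with closures of open upsets is preservation of arbitrary joins by \<open>h\<close>.
\<close>
lemma L_morphism_if_frame_hom:
  assumes h: "frame_hom L M h" and f: "f \<in> points Y \<rightarrow> points X" and dual: "dual_maps L \<phi> \<psi> Y h f"
  shows "L_morphism Y X f"
  unfolding L_morphism_def continuous_map_def
proof (intro conjI allI impI f)
  have hL: "h a \<in> carrier M" if "a \<in> carrier L" for a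
    using h that by (auto simp: frame_hom_def)
  have mem: "f y \<in> \<phi> a \<longleftrightarrow> y \<in> \<psi> (h a)" if "a \<in> carrier L" "y \<in> points Y" for a y
    using dual that by (auto simp: dual_maps_def preimage_def)
  fix O' assume O': "openin (topo X) O'"
  have "\<exists>T. openin (topo Y) T \<and> y \<in> T \<and> T \<subseteq> {y \<in> points Y. f y \<in> O'}"
    if y: "y \<in> {y \<in> points Y. f y \<in> O'}" for y
  proof -
    obtain U V where UV: "U \<in> ClopUp X" "V \<in> ClopUp X" "f y \<in> U - V" "U - V \<subseteq> O'"
      using dom.clopen_basis[OF O'] y by blast
    obtain a b where ab: "a \<in> carrier L" "\<phi> a = U" "b \<in> carrier L" "\<phi> b = V"
      using dom.\<phi>_surj UV(1,2) by metis
    have "openin (topo Y) (\<psi> (h a) - \<psi> (h b))"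
      using ClopUpD cod.\<phi>_ClopUp hL ab by (metis openin_diff)
    moreover have "y \<in> \<psi> (h a) - \<psi> (h b)"
      using mem y UV(3) ab by auto
    moreover have "z \<in> points Y \<and> f z \<in> O'" if "z \<in> \<psi> (h a) - \<psi> (h b)" for z
      using mem[of _ z] that ab UV(4) ClopUpD(5)[OF cod.\<phi>_ClopUp[OF hL[OF ab(1)]]] by blast
    ultimately show ?thesis by blast
  qed
  then show "openin (topo Y) {y \<in> points Y. f y \<in> O'}"
    by (subst openin_subopen) blast
next
  fix y z assume yz: "(y, z) \<in> ord Y"
  have yz': "y \<in> points Y" "z \<in> points Y" using cod.ord_points[OF yz] by auto
  show "(f y, f z) \<in> ord X"
  proof (rule ccontr)
    assume "(f y, f z) \<notin> ord X"
    then obtain U where U: "U \<in> ClopUp X" "f y \<in> U" "f z \<notin> U"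
      using dom.ord_separated[of "f y" "f z"] f yz' by auto
    obtain a where a: "a \<in> carrier L" "\<phi> a = U" using dom.\<phi>_surj[OF U(1)] by auto
    have "h a \<in> carrier M" using h a by (auto simp: frame_hom_def)
    then have "y \<in> \<psi> (h a) \<longrightarrow> z \<in> \<psi> (h a)"
      using cod.upset_up[OF ClopUpD(3)[OF cod.\<phi>_ClopUp] _ yz] by blast
    then show False
      using dual a U(2,3) yz' by (auto simp: dual_maps_def preimage_def)
  qed
next
  fix W assume "open_upset X W"
  then obtain S where S: "S \<subseteq> carrier L" "W = \<Union>(\<phi> ` S)"
    using dom.open_upset_eq_\<phi> by (metis (no_types, lifting) mem_Collect_eq subsetI)
  have hS: "h ` S \<subseteq> carrier M" using h S(1) by (auto simp: frame_hom_def)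
  have "preimage Y f (cl X W) = \<psi> (h (\<Squnion>\<^bsub>L\<^esub>S))"
    using dom.\<phi>_sup[OF S(1)] S(2) dual_mapsD[OF dual dom.sup_closed[OF S(1)]] by simp
  also have "\<dots> = cl Y (\<Union>(\<psi> ` h ` S))"
    using h S(1) cod.\<phi>_sup[OF hS] by (simp add: frame_hom_def)
  also have "\<dots> = cl Y (preimage Y f W)"
    using dual_maps_Union[OF dual S(1)] S(2) by simp
  finally show "preimage Y f (cl X W) = cl Y (preimage Y f W)" .
qed

lemma frame_hom_if_L_morphism:
  assumes f: "L_morphism Y X f" and h: "h \<in> carrier L \<rightarrow> carrier M" and dual: "dual_maps L \<phi> \<psi> Y h f"
  shows "frame_hom L M h"
  unfolding frame_hom_def
proof (intro conjI allI impI h)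
  fix S assume S: "S \<subseteq> carrier L"
  have hS: "h ` S \<subseteq> carrier M" using h S by auto
  show "h (\<Sqinter>\<^bsub>L\<^esub>S) = \<Sqinter>\<^bsub>M\<^esub>(h ` S)" if "finite S"
  proof (rule cod.\<phi>_inj)
    have "\<psi> (h (\<Sqinter>\<^bsub>L\<^esub>S)) = preimage Y f (points X \<inter> \<Inter>(\<phi> ` S))"
      using dual_mapsD[OF dual dom.inf_closed[OF S]] dom.\<phi>_inf_finite[OF S that] by simp
    also have "\<dots> = points Y \<inter> (\<Inter>a\<in>S. preimage Y f (\<phi> a))"
      using f by (auto simp: preimage_def L_morphism_def continuous_map_def)
    also have "\<dots> = points Y \<inter> \<Inter>(\<psi> ` h ` S)"
      using dual_mapsD[OF dual subsetD[OF S]] by auto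
    finally show "\<psi> (h (\<Sqinter>\<^bsub>L\<^esub>S)) = \<psi> (\<Sqinter>\<^bsub>M\<^esub>(h ` S))"
      using cod.\<phi>_inf_finite[OF hS] that by simp
  qed (use h S hS dom.inf_closed[OF S] cod.inf_closed[OF hS] in auto)
  show "h (\<Squnion>\<^bsub>L\<^esub>S) = \<Squnion>\<^bsub>M\<^esub>(h ` S)"
  proof (rule cod.\<phi>_inj)
    have "\<psi> (h (\<Squnion>\<^bsub>L\<^esub>S)) = preimage Y f (cl X (\<Union>(\<phi> ` S)))"
      using dual_mapsD[OF dual dom.sup_closed[OF S]] dom.\<phi>_sup[OF S] by simp
    also have "\<dots> = cl Y (preimage Y f (\<Union>(\<phi> ` S)))"
      using f dom.open_upset_Union[OF dom.\<phi>_image[OF S]] by (simp add: L_morphism_def)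
    also have "\<dots> = \<psi> (\<Squnion>\<^bsub>M\<^esub>(h ` S))"
      using cod.\<phi>_sup[OF hS] dual_maps_Union[OF dual S] by simp
    finally show "\<psi> (h (\<Squnion>\<^bsub>L\<^esub>S)) = \<psi> (\<Squnion>\<^bsub>M\<^esub>(h ` S))" .
  qed (use h dom.sup_closed[OF S] cod.sup_closed[OF hS] in auto)
qed

text \<open>
  The kernel of \<open>\<phi> b\<close> is the union of the \<open>\<phi> a\<close> with \<open>a \<ll> b\<close>. From right to left one needs that the
  compact set \<open>\<psi> (h a)\<close>, once it lies in the kernel of \<open>\<psi> (h b)\<close>, lies in a single member of the union.
\<close>
lemma proper_iff:
  assumes h: "frame_hom L M h" and f: "L_morphism Y X f" and dual: "dual_maps L \<phi> \<psi> Y h f"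
  shows "proper_frame_hom L M h \<longleftrightarrow> proper_L_morphism Y X f"
proof -
  have hL: "h a \<in> carrier M" if "a \<in> carrier L" for a
    using h that by (auto simp: frame_hom_def)
  have pre: "preimage Y f (\<phi> a) = \<psi> (h a)" if "a \<in> carrier L" for a
    using dual that by (simp add: dual_maps_def)
  have pre_ker: "preimage Y f (ker X (\<phi> b)) = (\<Union>a\<in>{a \<in> carrier L. way_below L a b}. \<psi> (h a))"
    if "b \<in> carrier L" for b
    using dual_maps_Union[OF dual, of "{a \<in> carrier L. way_below L a b}"] dom.ker_\<phi>[OF that]
    by (simp add: image_image)
  have "(\<forall>a\<in>carrier L. way_below L a b \<longrightarrow> way_below M (h a) (h b)) \<longleftrightarrow>
      preimage Y f (ker X (\<phi> b)) \<subseteq> ker Y (preimage Y f (\<phi> b))" if b: "b \<in> carrier L" for b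
  proof
    assume "\<forall>a\<in>carrier L. way_below L a b \<longrightarrow> way_below M (h a) (h b)"
    then show "preimage Y f (ker X (\<phi> b)) \<subseteq> ker Y (preimage Y f (\<phi> b))"
      using hL unfolding pre_ker[OF b] pre[OF b] cod.ker_\<phi>[OF hL[OF b]] by blast
  next
    assume sub: "preimage Y f (ker X (\<phi> b)) \<subseteq> ker Y (preimage Y f (\<phi> b))"
    show "\<forall>a\<in>carrier L. way_below L a b \<longrightarrow> way_below M (h a) (h b)"
    proof (intro ballI impI)
      fix a assume a: "a \<in> carrier L" "way_below L a b"
      have "\<psi> (h a) \<subseteq> ker Y (\<psi> (h b))"
        using sub a unfolding pre_ker[OF b] pre[OF b] by blast
      moreover have "compactin (topo Y) (\<psi> (h a))"
        by (rule cod.closed_compact[OF ClopUpD(2)[OF cod.\<phi>_ClopUp[OF hL[OF a(1)]]]])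
      ultimately obtain V where "\<psi> (h a) \<subseteq> V" "space_way_below Y V (\<psi> (h b))"
        using cod.compact_below_ker by blast
      then have "space_way_below Y (\<psi> (h a)) (\<psi> (h b))"
        using cod.way_below_mono by blast
      then show "way_below M (h a) (h b)"
        using cod.way_below_iff hL a(1) b by simp
    qed
  qed
  then have "(\<forall>b\<in>carrier L. \<forall>a\<in>carrier L. way_below L a b \<longrightarrow> way_below M (h a) (h b)) \<longleftrightarrow>
      (\<forall>U\<in>ClopUp X. preimage Y f (ker X U) \<subseteq> ker Y (preimage Y f U))"
    by (simp add: dom.ClopUp_eq)
  then show ?thesis
    using h f by (auto simp: proper_frame_hom_def proper_L_morphism_def)
qed

lemma dual_hom_exists:
  assumes f: "L_morphism Y X f"
  shows "\<exists>h\<in>extensional (carrier L). h \<in> carrier L \<rightarrow> carrier M \<and> dual_maps L \<phi> \<psi> Y h f"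
proof -
  have "\<exists>b\<in>carrier M. \<psi> b = preimage Y f (\<phi> a)" if "a \<in> carrier L" for a
    by (rule cod.\<phi>_surj[OF preimage_ClopUp[OF cod.priestley dom.priestley f dom.\<phi>_ClopUp[OF that]]])
  then obtain g where "\<And>a. a \<in> carrier L \<Longrightarrow> g a \<in> carrier M \<and> \<psi> (g a) = preimage Y f (\<phi> a)"
    by metis
  then show ?thesis
    by (intro bexI[of _ "restrict g (carrier L)"]) (auto simp: dual_maps_def)
qed

lemma dual_map_unique:
  assumes "dual_maps L \<phi> \<psi> Y h f" "dual_maps L \<phi> \<psi> Y h f'"
    and "f \<in> extensional (points Y)" "f' \<in> extensional (points Y)"
    and "f \<in> points Y \<rightarrow> points X" "f' \<in> points Y \<rightarrow> points X"
  shows "f = f'"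
proof (rule extensionalityI[OF assms(3,4)])
  fix y assume y: "y \<in> points Y"
  have "f y \<in> U \<longleftrightarrow> f' y \<in> U" if U: "U \<in> ClopUp X" for U
  proof -
    obtain a where "a \<in> carrier L" "\<phi> a = U" using dom.\<phi>_surj[OF U] by auto
    then have "preimage Y f U = preimage Y f' U"
      using assms(1,2) by (auto simp: dual_maps_def)
    then show ?thesis using y by (auto simp: preimage_def)
  qed
  then have "(f y, f' y) \<in> ord X" "(f' y, f y) \<in> ord X"
    using dom.ord_separated y assms(5,6) by (metis funcset_mem)+
  then show "f y = f' y" by (rule dom.ord_antisym)
qed

lemma dual_hom_unique:
  assumes "dual_maps L \<phi> \<psi> Y h f" "dual_maps L \<phi> \<psi> Y h' f"
    and "h \<in> extensional (carrier L)" "h' \<in> extensional (carrier L)"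
    and "h \<in> carrier L \<rightarrow> carrier M" "h' \<in> carrier L \<rightarrow> carrier M"
  shows "h = h'"
  using assms by (intro extensionalityI[OF assms(3,4)] cod.\<phi>_inj) (auto simp: dual_maps_def)

theorem proper_dual_map:
  assumes h: "proper_frame_hom L M h"
  shows "\<exists>!f. f \<in> extensional (points Y) \<and> proper_L_morphism Y X f \<and> dual_maps L \<phi> \<psi> Y h f"
proof -
  have hom: "frame_hom L M h" using h by (simp add: proper_frame_hom_def)
  obtain f where f: "f \<in> extensional (points Y)" "f \<in> points Y \<rightarrow> points X" "dual_maps L \<phi> \<psi> Y h f"
    using dual_map_exists[OF hom] by blast
  have "proper_L_morphism Y X f"
    using proper_iff[OF hom L_morphism_if_frame_hom[OF hom f(2,3)] f(3)] h by simp
  moreover have "f' = f" if "f' \<in> extensional (points Y)" "proper_L_morphism Y X f'" "dual_maps L \<phi> \<psi> Y h f'" for f'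
    using dual_map_unique[OF that(3) f(3) that(1) f(1) _ f(2)] that(2)
    by (simp add: proper_L_morphism_def L_morphism_def continuous_map_def)
  ultimately show ?thesis using f by blast
qed

theorem proper_dual_hom:
  assumes f: "proper_L_morphism Y X f"
  shows "\<exists>!h. h \<in> extensional (carrier L) \<and> proper_frame_hom L M h \<and> dual_maps L \<phi> \<psi> Y h f"
proof -
  have mor: "L_morphism Y X f" using f by (simp add: proper_L_morphism_def)
  obtain h where h: "h \<in> extensional (carrier L)" "h \<in> carrier L \<rightarrow> carrier M" "dual_maps L \<phi> \<psi> Y h f"
    using dual_hom_exists[OF mor] by blast
  have "proper_frame_hom L M h"
    using proper_iff[OF frame_hom_if_L_morphism[OF mor h(2,3)] mor h(3)] f by simp
  moreover have "h' = h" if "h' \<in> extensional (carrier L)" "proper_frame_hom L M h'" "dual_maps L \<phi> \<psi> Y h' f" for h'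
    using dual_hom_unique[OF that(3) h(3) that(1) h(1) _ h(2)] that(2)
    by (simp add: proper_frame_hom_def frame_hom_def)
  ultimately show ?thesis using h by blast
qed

end

section \<open>The space of prime filters of a frame\<close>

locale frame_lattice = complete_lattice L for L :: "'a gorder" (structure) +
  assumes frame: "is_frame L"
begin

lemma meet_join_distrib:
  assumes "a \<in> carrier L" "x \<in> carrier L" "y \<in> carrier L"
  shows "a \<sqinter> (x \<squnion> y) = (a \<sqinter> x) \<squnion> (a \<sqinter> y)"
proof -
  have "a \<sqinter> \<Squnion>{x, y} = \<Squnion>((\<lambda>s. a \<sqinter> s) ` {x, y})"
    by (rule frame[unfolded is_frame_def, THEN conjunct2, rule_format]) (use assms in auto)
  then show ?thesis by (simp add: join_def)
qed

definition prime_filter :: "'a set \<Rightarrow> bool" where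
  "prime_filter P \<longleftrightarrow> P \<subseteq> carrier L \<and> \<top> \<in> P \<and> \<bottom> \<notin> P \<and>
     (\<forall>x\<in>P. \<forall>y\<in>carrier L. x \<sqsubseteq> y \<longrightarrow> y \<in> P) \<and>
     (\<forall>x\<in>P. \<forall>y\<in>P. x \<sqinter> y \<in> P) \<and>
     (\<forall>x\<in>carrier L. \<forall>y\<in>carrier L. x \<squnion> y \<in> P \<longrightarrow> x \<in> P \<or> y \<in> P)"

lemma prime_filter_finite:
  assumes P: "prime_filter P"
  shows "\<lbrakk>finite T; T \<subseteq> P\<rbrakk> \<Longrightarrow> \<Sqinter>T \<in> P"
    and "\<lbrakk>finite S; S \<subseteq> carrier L; \<Squnion>S \<in> P\<rbrakk> \<Longrightarrow> \<exists>a\<in>S. a \<in> P"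
proof -
  have PL: "P \<subseteq> carrier L" using P by (simp add: prime_filter_def)
  have up: "y \<in> P" if "x \<in> P" "y \<in> carrier L" "x \<sqsubseteq> y" for x y
    using P that by (auto simp: prime_filter_def)
  show "\<Sqinter>T \<in> P" if "finite T" "T \<subseteq> P"
    using that
  proof (induction rule: finite_induct)
    case empty
    have "\<top> \<sqsubseteq> \<Sqinter>{}" by (rule inf_greatest) auto
    then show ?case using up[of \<top>] P by (simp add: prime_filter_def)
  next
    case (insert x T)
    then have T: "x \<in> carrier L" "T \<subseteq> carrier L" using PL by auto
    have "x \<sqinter> \<Sqinter>T \<sqsubseteq> \<Sqinter>(insert x T)"
    proof (rule inf_greatest)
      fix y assume "y \<in> insert x T"
      then consider "y = x" | "y \<in> T" by blast
      then show "x \<sqinter> \<Sqinter>T \<sqsubseteq> y"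
      proof cases
        case 2
        then have "y \<in> carrier L" using T(2) by blast
        with 2 show ?thesis
          using T meet_right[OF T(1) inf_closed[OF T(2)]] inf_lower[OF T(2) 2] le_trans by simp
      qed (use T meet_left in simp)
    qed (use T in auto)
    moreover have "x \<sqinter> \<Sqinter>T \<in> P"
      using insert P by (simp add: prime_filter_def)
    ultimately show ?case using up[of "x \<sqinter> \<Sqinter>T"] T by simp
  qed
  show "\<exists>a\<in>S. a \<in> P" if "finite S" "S \<subseteq> carrier L" "\<Squnion>S \<in> P"
    using that
  proof (induction rule: finite_induct)
    case empty
    have "\<Squnion>{} \<sqsubseteq> \<bottom>" by (rule sup_least) auto
    then show ?case using up[of "\<Squnion>{}" \<bottom>] empty P by (simp add: prime_filter_def)
  next
    case (insert x S)
    then have S: "x \<in> carrier L" "S \<subseteq> carrier L" by auto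
    have "\<Squnion>(insert x S) \<sqsubseteq> x \<squnion> \<Squnion>S"
    proof (rule sup_least)
      fix y assume "y \<in> insert x S"
      then consider "y = x" | "y \<in> S" by blast
      then show "y \<sqsubseteq> x \<squnion> \<Squnion>S"
      proof cases
        case 2
        then have "y \<in> carrier L" using S(2) by blast
        with 2 show ?thesis
          using S join_right[OF S(1) sup_closed[OF S(2)]] sup_upper[OF S(2) 2]
            le_trans[of y "\<Squnion>S" "x \<squnion> \<Squnion>S"] by simp
      qed (use S join_left in simp)
    qed (use S in auto)
    then have "x \<squnion> \<Squnion>S \<in> P" using up insert.prems S by simp
    then have "x \<in> P \<or> \<Squnion>S \<in> P"
      using P S by (simp add: prime_filter_def)
    then show ?case using insert by auto
  qed
qed

text \<open>
  The prime filter theorem in a form suited to compactness arguments, with \<open>A\<close> and \<open>B\<close> arbitrary sets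
  instead of an ideal and a filter. Zorn's lemma is applied to all subsets \<open>P\<close> containing \<open>B\<close> of which no
  finite meet is below a finite join from \<open>A\<close>. A maximal one is a filter, and it is prime by
  distributivity.
\<close>
theorem prime_filter_exists:
  assumes A: "A \<subseteq> carrier L" and B: "B \<subseteq> carrier L"
    and sep: "\<And>S T. \<lbrakk>finite S; S \<subseteq> A; finite T; T \<subseteq> B\<rbrakk> \<Longrightarrow> \<not> \<Sqinter>T \<sqsubseteq> \<Squnion>S"
  shows "\<exists>P. prime_filter P \<and> B \<subseteq> P \<and> P \<inter> A = {}"
proof -
  define \<B> where "\<B> = {P. B \<subseteq> P \<and> P \<subseteq> carrier L \<and>
    (\<forall>S T. finite S \<and> S \<subseteq> A \<and> finite T \<and> T \<subseteq> P \<longrightarrow> \<not> \<Sqinter>T \<sqsubseteq> \<Squnion>S)}"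
  have \<B>D: "B \<subseteq> P" "P \<subseteq> carrier L"
    "\<And>S T. \<lbrakk>finite S; S \<subseteq> A; finite T; T \<subseteq> P\<rbrakk> \<Longrightarrow> \<not> \<Sqinter>T \<sqsubseteq> \<Squnion>S" if "P \<in> \<B>" for P
    using that by (simp_all add: \<B>_def)
  have "\<exists>P\<in>\<B>. \<forall>Q\<in>\<B>. P \<subseteq> Q \<longrightarrow> Q = P"
  proof (rule subset_Zorn_nonempty)
    have "B \<in> \<B>" using B sep by (simp add: \<B>_def)
    then show "\<B> \<noteq> {}" by blast
    fix \<C> assume \<C>: "\<C> \<noteq> {}" "subset.chain \<B> \<C>"
    have sub: "\<C> \<subseteq> \<B>" using \<C>(2) by (simp add: subset_chain_def)
    have "\<not> \<Sqinter>T \<sqsubseteq> \<Squnion>S" if ST: "finite S" "S \<subseteq> A" "finite T" "T \<subseteq> \<Union>\<C>" for S T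
    proof -
      obtain P where P: "P \<in> \<C>" "T \<subseteq> P"
        using finite_subset_Union_chain[OF ST(3,4) \<C>] by blast
      then have "P \<in> \<B>" using sub by blast
      then show ?thesis by (rule \<B>D(3)[OF _ ST(1-3) P(2)])
    qed
    moreover have "B \<subseteq> \<Union>\<C>"
    proof -
      obtain P where "P \<in> \<C>" using \<C>(1) by blast
      then show ?thesis using \<B>D(1)[of P] sub by blast
    qed
    moreover have "\<Union>\<C> \<subseteq> carrier L" using sub \<B>D(2) by (intro Union_least) auto
    ultimately show "\<Union>\<C> \<in> \<B>" by (simp add: \<B>_def)
  qed
  then obtain P where P: "P \<in> \<B>" and max: "\<And>Q. \<lbrakk>Q \<in> \<B>; P \<subseteq> Q\<rbrakk> \<Longrightarrow> Q = P" by metis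
  note BP = \<B>D(1)[OF P] and PL = \<B>D(2)[OF P] and not_le = \<B>D(3)[OF P]
  \<comment> \<open>by maximality, an element is left out of \<open>P\<close> exactly if adding it would break the separation\<close>
  define bad where "bad x S T \<longleftrightarrow> finite S \<and> S \<subseteq> A \<and> finite T \<and> T \<subseteq> P \<and> x \<sqinter> \<Sqinter>T \<sqsubseteq> \<Squnion>S" for x S T
  have mem: "x \<in> P \<longleftrightarrow> (\<nexists>S T. bad x S T)" if x: "x \<in> carrier L" for x
  proof
    assume xP: "x \<in> P"
    have "\<not> bad x S T" for S T
    proof
      assume b: "bad x S T"
      then have TL: "T \<subseteq> carrier L" "insert x T \<subseteq> carrier L" "S \<subseteq> carrier L"
        using x A PL by (auto simp: bad_def)
      have "\<Sqinter>(insert x T) \<sqsubseteq> x \<sqinter> \<Sqinter>T"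
        using TL x by (intro meet_le inf_lower inf_greatest) auto
      then have "\<Sqinter>(insert x T) \<sqsubseteq> \<Squnion>S"
        using b TL x le_trans[of "\<Sqinter>(insert x T)" "x \<sqinter> \<Sqinter>T" "\<Squnion>S"] by (simp add: bad_def)
      then show False using not_le[of S "insert x T"] b xP by (simp add: bad_def)
    qed
    then show "\<nexists>S T. bad x S T" by blast
  next
    assume no: "\<nexists>S T. bad x S T"
    have "insert x P \<in> \<B>"
      unfolding \<B>_def
    proof (intro CollectI conjI allI impI)
      show "B \<subseteq> insert x P" "insert x P \<subseteq> carrier L" using BP PL x by auto
      fix S T assume ST: "finite S \<and> S \<subseteq> A \<and> finite T \<and> T \<subseteq> insert x P"
      let ?T = "T - {x}"
      have TL: "T \<subseteq> carrier L" "?T \<subseteq> carrier L" "S \<subseteq> carrier L" using ST PL x A by auto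
      have "x \<sqinter> \<Sqinter>?T \<sqsubseteq> \<Sqinter>T"
      proof (rule inf_greatest[OF TL(1)])
        fix y assume y: "y \<in> T"
        show "x \<sqinter> \<Sqinter>?T \<sqsubseteq> y"
        proof (cases "y = x")
          case True
          then show ?thesis using meet_left x TL by simp
        next
          case False
          then have "y \<in> ?T" "y \<in> carrier L" using y TL by auto
          then show ?thesis
            using meet_right[OF x inf_closed[OF TL(2)]] inf_lower[OF TL(2)] x TL
              le_trans[of "x \<sqinter> \<Sqinter>?T" "\<Sqinter>?T" y] by simp
        qed
      qed (use x TL in simp)
      then have "bad x S ?T" if "\<Sqinter>T \<sqsubseteq> \<Squnion>S"
        using that ST TL x le_trans[of "x \<sqinter> \<Sqinter>?T" "\<Sqinter>T" "\<Squnion>S"] by (auto simp: bad_def)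
      then show "\<not> \<Sqinter>T \<sqsubseteq> \<Squnion>S" using no by blast
    qed
    then show "x \<in> P" using max[of "insert x P"] by auto
  qed
  have bad_mono: "bad x S' T'"
    if b: "bad x S T" and x: "x \<in> carrier L" and sub: "S \<subseteq> S'" "S' \<subseteq> A" "finite S'" "T \<subseteq> T'" "T' \<subseteq> P" "finite T'"
    for x S T S' T'
  proof -
    have L: "S \<subseteq> carrier L" "S' \<subseteq> carrier L" "T \<subseteq> carrier L" "T' \<subseteq> carrier L"
      using sub A PL by auto
    have 1: "\<Sqinter>T' \<sqsubseteq> \<Sqinter>T" using L sub by (intro inf_greatest) (auto intro: inf_lower)
    have 2: "\<Squnion>S \<sqsubseteq> \<Squnion>S'" using L sub by (intro sup_least) (auto intro: sup_upper)
    have "x \<sqinter> \<Sqinter>T' \<sqsubseteq> x \<sqinter> \<Sqinter>T"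
      using x L 1 meet_right[OF x, of "\<Sqinter>T'"] le_trans[of "x \<sqinter> \<Sqinter>T'" "\<Sqinter>T'" "\<Sqinter>T"]
      by (intro meet_le) (auto intro: meet_left)
    also have "\<dots> \<sqsubseteq> \<Squnion>S" using b by (simp add: bad_def)
    also note 2
    finally show ?thesis using sub x L by (simp add: bad_def)
  qed
  have bad_le: "bad x S T" if b: "bad y S T" and xy: "x \<in> carrier L" "y \<in> carrier L" "x \<sqsubseteq> y" for x y S T
  proof -
    have L: "S \<subseteq> carrier L" "T \<subseteq> carrier L" using b A PL by (auto simp: bad_def)
    have "x \<sqinter> \<Sqinter>T \<sqsubseteq> y \<sqinter> \<Sqinter>T"
      using xy L meet_left[OF xy(1), of "\<Sqinter>T"] le_trans[of "x \<sqinter> \<Sqinter>T" x y]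
      by (intro meet_le) (auto intro: meet_right)
    then show ?thesis
      using b xy L le_trans[of "x \<sqinter> \<Sqinter>T" "y \<sqinter> \<Sqinter>T" "\<Squnion>S"] by (simp add: bad_def)
  qed
  have up: "y \<in> P" if xy: "x \<in> P" "y \<in> carrier L" "x \<sqsubseteq> y" for x y
  proof -
    have "x \<in> carrier L" using xy(1) PL by blast
    then show ?thesis
      using mem[of x] mem[of y] xy bad_le[of y _ _ x] by blast
  qed
  have "prime_filter P"
    unfolding prime_filter_def
  proof (intro conjI ballI impI)
    show "P \<subseteq> carrier L" by (rule PL)
    have "\<not> bad \<top> S T" for S T
    proof
      assume b: "bad \<top> S T"
      then have L: "S \<subseteq> carrier L" "T \<subseteq> carrier L" using A PL by (auto simp: bad_def)
      have "\<Sqinter>T \<sqsubseteq> \<top> \<sqinter> \<Sqinter>T" using L by (intro meet_le) auto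
      then have "\<Sqinter>T \<sqsubseteq> \<Squnion>S"
        using b L le_trans[of "\<Sqinter>T" "\<top> \<sqinter> \<Sqinter>T" "\<Squnion>S"] by (simp add: bad_def)
      then show False using not_le b by (simp add: bad_def)
    qed
    then show "\<top> \<in> P" using mem[of \<top>] by simp
    have "\<bottom> \<sqinter> \<Sqinter>{} \<sqsubseteq> \<Squnion>{}"
      using meet_left[of \<bottom> "\<Sqinter>{}"] le_trans[of "\<bottom> \<sqinter> \<Sqinter>{}" \<bottom> "\<Squnion>{}"] by simp
    then have "bad \<bottom> {} {}" by (simp add: bad_def)
    then show "\<bottom> \<notin> P" using mem[of \<bottom>] by auto
  next
    fix x y assume "x \<in> P" "y \<in> carrier L" "x \<sqsubseteq> y"
    then show "y \<in> P" by (rule up)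
  next
    fix x y assume xy: "x \<in> P" "y \<in> P"
    have xyL: "x \<in> carrier L" "y \<in> carrier L" using xy PL by auto
    have "\<not> bad (x \<sqinter> y) S T" for S T
    proof
      assume b: "bad (x \<sqinter> y) S T"
      then have L: "S \<subseteq> carrier L" "T \<subseteq> carrier L" "insert y T \<subseteq> carrier L"
        using A PL xyL by (auto simp: bad_def)
      have 1: "\<Sqinter>(insert y T) \<sqsubseteq> y" "\<Sqinter>(insert y T) \<sqsubseteq> \<Sqinter>T"
        using L inf_lower[OF L(3)] by (auto intro!: inf_greatest)
      have 2: "x \<sqinter> \<Sqinter>(insert y T) \<sqsubseteq> \<Sqinter>(insert y T)" "x \<sqinter> \<Sqinter>(insert y T) \<sqsubseteq> x"
        using L xyL by (auto intro: meet_right meet_left)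
      have "x \<sqinter> \<Sqinter>(insert y T) \<sqsubseteq> (x \<sqinter> y) \<sqinter> \<Sqinter>T"
        using 1 2 xyL L le_trans[OF 2(1) 1(1)] le_trans[OF 2(1) 1(2)] by (intro meet_le) auto
      then have "x \<sqinter> \<Sqinter>(insert y T) \<sqsubseteq> \<Squnion>S"
        using b xyL L le_trans[of "x \<sqinter> \<Sqinter>(insert y T)" "(x \<sqinter> y) \<sqinter> \<Sqinter>T" "\<Squnion>S"] by (simp add: bad_def)
      then have "bad x S (insert y T)" using b xy(2) by (simp add: bad_def)
      then show False using mem[OF xyL(1)] xy(1) by blast
    qed
    then show "x \<sqinter> y \<in> P" using mem[of "x \<sqinter> y"] xyL by simp
  next
    fix x y assume xyL: "x \<in> carrier L" "y \<in> carrier L" and j: "x \<squnion> y \<in> P"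
    show "x \<in> P \<or> y \<in> P"
    proof (rule ccontr)
      assume "\<not> (x \<in> P \<or> y \<in> P)"
      then obtain S1 T1 S2 T2 where b: "bad x S1 T1" "bad y S2 T2"
        using mem xyL by blast
      define S T where "S = S1 \<union> S2" and "T = T1 \<union> T2"
      have fin: "finite S" "S \<subseteq> A" "finite T" "T \<subseteq> P"
        using b by (auto simp: bad_def S_def T_def)
      have b': "bad x S T" "bad y S T"
        using bad_mono[OF b(1) xyL(1), of S T] bad_mono[OF b(2) xyL(2), of S T] fin
        by (auto simp: S_def T_def)
      have L: "S \<subseteq> carrier L" "T \<subseteq> carrier L" using fin A PL by auto
      have comm: "z \<sqinter> \<Sqinter>T = \<Sqinter>T \<sqinter> z" for z
        by (simp add: meet_def insert_commute)
      have "(x \<squnion> y) \<sqinter> \<Sqinter>T = (\<Sqinter>T \<sqinter> x) \<squnion> (\<Sqinter>T \<sqinter> y)"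
        unfolding comm using xyL L by (intro meet_join_distrib) auto
      also have "\<dots> \<sqsubseteq> \<Squnion>S"
        using b' xyL L unfolding bad_def comm by (intro join_le) auto
      finally have "bad (x \<squnion> y) S T" using fin by (simp add: bad_def)
      then show False using mem[of "x \<squnion> y"] j xyL by auto
    qed
  qed
  moreover have "x \<notin> P" if x: "x \<in> A" for x
  proof -
    have xL: "x \<in> carrier L" using x A by blast
    have "x \<sqinter> \<Sqinter>{} \<sqsubseteq> \<Squnion>{x}"
      using xL meet_left[OF xL, of "\<Sqinter>{}"] by simp
    then have "bad x {x} {}" using x by (simp add: bad_def)
    then show ?thesis using mem[OF xL] by blast
  qed
  ultimately show ?thesis using BP by blast
qed

definition spec :: "'a set set" where
  "spec = {P. prime_filter P}"

definition basic :: "'a \<Rightarrow> 'a set set" where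
  "basic a = {P \<in> spec. a \<in> P}"

definition subbase :: "'a set set set" where
  "subbase = basic ` carrier L \<union> (\<lambda>a. spec - basic a) ` carrier L"

definition spectrum :: "'a set ordered_space" where
  "spectrum = \<lparr>topo = topology (arbitrary union_of (finite intersection_of (\<lambda>U. U \<in> subbase) relative_to spec)),
     ord = {(P, Q). P \<in> spec \<and> Q \<in> spec \<and> P \<subseteq> Q}\<rparr>"

lemma points_spectrum [simp]: "points spectrum = spec"
  by (simp add: spectrum_def)

lemma subbase_open: "U \<in> subbase \<Longrightarrow> openin (topo spectrum) U"
proof -
  assume U: "U \<in> subbase"
  then have "U \<subseteq> spec" by (auto simp: subbase_def basic_def)
  then show ?thesis
    using U by (simp add: spectrum_def openin_subbase arbitrary_union_of_inc relative_to_subset_inc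
        finite_intersection_of_inc)
qed

lemma basic_clopen:
  assumes "a \<in> carrier L"
  shows "openin (topo spectrum) (basic a)" "closedin (topo spectrum) (basic a)"
proof -
  have "basic a \<in> subbase" "spec - basic a \<in> subbase"
    using assms by (auto simp: subbase_def)
  then have "openin (topo spectrum) (basic a)" "openin (topo spectrum) (spec - basic a)"
    by (simp_all add: subbase_open)
  then show "openin (topo spectrum) (basic a)" "closedin (topo spectrum) (basic a)"
    by (simp_all add: closedin_def basic_def)
qed

text \<open>
  By Alexander's subbase theorem only covers by sets \<open>basic a\<close>, for \<open>a \<in> A\<close>, and complements of sets
  \<open>basic b\<close>, for \<open>b \<in> B\<close>, matter. A prime filter containing \<open>B\<close> and disjoint from \<open>A\<close> would not be covered, so
  there is none; hence some finite meet from \<open>B\<close> is below a finite join from \<open>A\<close>, which is a finite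
  subcover.
\<close>
lemma compact_spectrum: "compact_space (topo spectrum)"
proof (rule Alexander_subbase_alt)
  show "topology (arbitrary union_of (finite intersection_of (\<lambda>U. U \<in> subbase) relative_to spec)) = topo spectrum"
    by (simp add: spectrum_def)
  have "basic \<top> = spec"
    by (auto simp: basic_def spec_def prime_filter_def)
  then have "spec \<in> subbase"
    unfolding subbase_def by (metis UnI1 imageI top_closed)
  then show "spec \<subseteq> \<Union>subbase" by blast
  fix \<C> assume \<C>: "\<C> \<subseteq> subbase" "spec \<subseteq> \<Union>\<C>"
  define A where "A = {a \<in> carrier L. basic a \<in> \<C>}"
  define B where "B = {b \<in> carrier L. spec - basic b \<in> \<C>}"
  have AB: "A \<subseteq> carrier L" "B \<subseteq> carrier L" by (auto simp: A_def B_def)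
  show "\<exists>\<C>'. finite \<C>' \<and> \<C>' \<subseteq> \<C> \<and> spec \<subseteq> \<Union>\<C>'"
  proof (rule ccontr)
    assume no: "\<not> ?thesis"
    have "\<not> \<Sqinter>T \<sqsubseteq> \<Squnion>S" if ST: "finite S" "S \<subseteq> A" "finite T" "T \<subseteq> B" for S T
    proof
      assume le: "\<Sqinter>T \<sqsubseteq> \<Squnion>S"
      have L: "S \<subseteq> carrier L" "T \<subseteq> carrier L" using ST AB by auto
      let ?\<C> = "basic ` S \<union> (\<lambda>b. spec - basic b) ` T"
      have "P \<in> \<Union>?\<C>" if P: "P \<in> spec" for P
      proof (cases "T \<subseteq> P")
        case True
        have pf: "prime_filter P" using P by (simp add: spec_def)
        then have "\<Sqinter>T \<in> P" using prime_filter_finite(1) ST(3) True by blast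
        then have "\<Squnion>S \<in> P" using pf le L by (auto simp: prime_filter_def)
        then obtain a where "a \<in> S" "a \<in> P" using prime_filter_finite(2)[OF pf ST(1) L(1)] by blast
        then show ?thesis using P by (auto simp: basic_def)
      next
        case False
        then show ?thesis using P by (auto simp: basic_def)
      qed
      moreover have "?\<C> \<subseteq> \<C>" using ST by (auto simp: A_def B_def)
      ultimately show False using no ST by (metis finite_Un finite_imageI subsetI)
    qed
    then obtain P where P: "prime_filter P" "B \<subseteq> P" "P \<inter> A = {}"
      using prime_filter_exists[OF AB] by blast
    then have Ps: "P \<in> spec" by (simp add: spec_def)
    then obtain U where "U \<in> \<C>" "P \<in> U" using \<C>(2) by blast
    then show False
      using \<C>(1) P Ps by (auto simp: subbase_def A_def B_def basic_def)
  qed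
qed

lemma basic_subset_iff:
  assumes ab: "a \<in> carrier L" "b \<in> carrier L"
  shows "a \<sqsubseteq> b \<longleftrightarrow> basic a \<subseteq> basic b"
proof
  assume "a \<sqsubseteq> b"
  then show "basic a \<subseteq> basic b"
    using ab by (auto simp: basic_def spec_def prime_filter_def)
next
  assume sub: "basic a \<subseteq> basic b"
  show "a \<sqsubseteq> b"
  proof (rule ccontr)
    assume not: "\<not> a \<sqsubseteq> b"
    have "\<not> \<Sqinter>T \<sqsubseteq> \<Squnion>S" if ST: "finite S" "S \<subseteq> {b}" "finite T" "T \<subseteq> {a}" for S T
    proof
      assume le: "\<Sqinter>T \<sqsubseteq> \<Squnion>S"
      have L: "S \<subseteq> carrier L" "T \<subseteq> carrier L" using ST ab by auto
      have "a \<sqsubseteq> \<Sqinter>T" using ST ab L by (intro inf_greatest) auto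
      moreover have "\<Squnion>S \<sqsubseteq> b" using ST ab L by (intro sup_least) auto
      ultimately show False
        using not le L ab le_trans[of a "\<Sqinter>T" "\<Squnion>S"] le_trans[of a "\<Squnion>S" b] by simp
    qed
    then obtain P where "prime_filter P" "{a} \<subseteq> P" "P \<inter> {b} = {}"
      using prime_filter_exists[of "{b}" "{a}"] ab by auto
    then show False using sub by (auto simp: basic_def spec_def)
  qed
qed

lemma basic_meet: "\<lbrakk>a \<in> carrier L; b \<in> carrier L\<rbrakk> \<Longrightarrow> basic a \<inter> basic b = basic (a \<sqinter> b)"
  using meet_left[of a b] meet_right[of a b] meet_closed[of a b]
  unfolding basic_def spec_def prime_filter_def by blast

lemma basic_join: "\<lbrakk>a \<in> carrier L; b \<in> carrier L\<rbrakk> \<Longrightarrow> basic a \<union> basic b = basic (a \<squnion> b)"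
  using join_left[of a b] join_right[of a b] join_closed[of a b]
  unfolding basic_def spec_def prime_filter_def by blast

lemma basic_top: "basic \<top> = spec" and basic_bottom: "basic \<bottom> = {}"
  by (auto simp: basic_def spec_def prime_filter_def)

lemma basic_ClopUp: "a \<in> carrier L \<Longrightarrow> basic a \<in> ClopUp spectrum"
proof -
  assume a: "a \<in> carrier L"
  have "basic a = up spectrum (basic a)"
    by (auto simp: up_def basic_def spectrum_def)
  then show ?thesis
    using basic_clopen[OF a] unfolding ClopUp_def clopen_def upset_def by (simp add: basic_def)
qed

lemma priestley_spectrum: "priestley_space spectrum"
  unfolding priestley_space_def
proof (intro conjI ballI impI)
  show "compact_space (topo spectrum)" by (rule compact_spectrum)
  show "partial_order_on (points spectrum) (ord spectrum)"
    by (auto simp: order_on_defs refl_on_def trans_def antisym_def spectrum_def)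
  fix P Q assume PQ: "P \<in> points spectrum" "Q \<in> points spectrum" "(P, Q) \<notin> ord spectrum"
  then obtain a where "a \<in> P" "a \<notin> Q" by (auto simp: spectrum_def)
  moreover have "a \<in> carrier L"
    using PQ(1) \<open>a \<in> P\<close> by (auto simp: spec_def prime_filter_def)
  ultimately show "\<exists>U\<in>ClopUp spectrum. P \<in> U \<and> Q \<notin> U"
    using PQ basic_ClopUp by (intro bexI[of _ "basic a"]) (auto simp: basic_def)
qed

text \<open>
  Surjectivity is the point: by compactness a clopen upset \<open>U\<close> is separated from its complement by a set
  \<open>basic a\<close>, since these sets form a lattice and distinguish \<open>P\<close> from \<open>Q\<close> whenever \<open>\<not> P \<subseteq> Q\<close>.
\<close>
theorem represents_spectrum: "represents L basic spectrum"
proof -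
  interpret priestley spectrum by unfold_locales (rule priestley_spectrum)
  have "U \<in> basic ` carrier L" if U: "U \<in> ClopUp spectrum" for U
  proof -
    have "\<exists>V\<in>basic ` carrier L. U \<subseteq> V \<and> V \<inter> (spec - U) = {}"
    proof (rule separate_compact_sets)
      show "compactin (topo spectrum) U" "compactin (topo spectrum) (spec - U)"
        using ClopUpD[OF U] closedin_diff[of "topo spectrum" spec U] closedin_topspace[of "topo spectrum"]
        by (auto intro!: closed_compact)
      show "\<exists>V\<in>basic ` carrier L. P \<in> V \<and> Q \<notin> V" if PQ: "P \<in> U" "Q \<in> spec - U" for P Q
      proof -
        have "P \<in> spec" using PQ(1) ClopUpD(5)[OF U] by auto
        moreover have "(P, Q) \<notin> ord spectrum"
          using upset_up[OF ClopUpD(3)[OF U] PQ(1)] PQ(2) by blast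
        ultimately obtain a where "a \<in> P" "a \<notin> Q" using PQ(2) by (auto simp: spectrum_def)
        moreover have "a \<in> carrier L"
          using \<open>P \<in> spec\<close> \<open>a \<in> P\<close> by (auto simp: spec_def prime_filter_def)
        ultimately show ?thesis using \<open>P \<in> spec\<close> by (auto simp: basic_def)
      qed
      show "openin (topo spectrum) V \<and> closedin (topo spectrum) V" if "V \<in> basic ` carrier L" for V
        using that basic_clopen by auto
      show "topspace (topo spectrum) \<in> basic ` carrier L"
        using basic_top by (metis imageI points_spectrum top_closed)
      show "{} \<in> basic ` carrier L"
        using basic_bottom by (metis imageI bottom_closed)
      show "V \<inter> W \<in> basic ` carrier L" "V \<union> W \<in> basic ` carrier L"
        if "V \<in> basic ` carrier L" "W \<in> basic ` carrier L" for V W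
        using that by (auto simp: basic_meet basic_join)
    qed
    then obtain a where a: "a \<in> carrier L" "U \<subseteq> basic a" "basic a \<inter> (spec - U) = {}" by auto
    then have "basic a = U" by (auto simp: basic_def)
    then show ?thesis using a(1) by blast
  qed
  then have "basic ` carrier L = ClopUp spectrum" using basic_ClopUp by blast
  moreover have "inj_on basic (carrier L)"
    using basic_subset_iff by (intro inj_onI le_antisym) auto
  ultimately show ?thesis
    using priestley_spectrum partial_order_axioms basic_subset_iff
    by (simp add: represents_def bij_betw_def)
qed

end

section \<open>The dual equivalence\<close>

lemma proper_frame_hom_id:
  assumes "is_frame L"
  shows "proper_frame_hom L L (restrict id (carrier L))"
proof -
  interpret complete_lattice L using assms by (rule is_frame_complete)
  have "restrict id (carrier L) ` S = S" if "S \<subseteq> carrier L" for S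
    using that by (auto simp: image_iff subset_iff)
  then show ?thesis
    by (simp add: proper_frame_hom_def frame_hom_def)
qed

lemma proper_frame_hom_compose:
  assumes "is_frame L" and f: "proper_frame_hom L M f" and g: "proper_frame_hom M N g"
  shows "proper_frame_hom L N (compose (carrier L) g f)"
proof -
  interpret complete_lattice L using assms(1) by (rule is_frame_complete)
  have maps: "f \<in> carrier L \<rightarrow> carrier M" "g \<in> carrier M \<rightarrow> carrier N"
    using f g by (auto simp: proper_frame_hom_def frame_hom_def)
  have image: "compose (carrier L) g f ` S = g ` f ` S" "f ` S \<subseteq> carrier M" if "S \<subseteq> carrier L" for S
    using that maps(1) by (auto simp: compose_eq image_iff subset_iff)
  have "frame_hom L N (compose (carrier L) g f)"
    unfolding frame_hom_def
  proof (intro conjI allI impI)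
    show "compose (carrier L) g f \<in> carrier L \<rightarrow> carrier N"
      using maps by (auto simp: compose_eq)
    fix S assume S: "S \<subseteq> carrier L"
    show "compose (carrier L) g f (\<Squnion>\<^bsub>L\<^esub>S) = \<Squnion>\<^bsub>N\<^esub>(compose (carrier L) g f ` S)"
      using f g S image[OF S] by (simp add: compose_eq proper_frame_hom_def frame_hom_def)
    show "compose (carrier L) g f (\<Sqinter>\<^bsub>L\<^esub>S) = \<Sqinter>\<^bsub>N\<^esub>(compose (carrier L) g f ` S)" if "finite S"
      using f g S image[OF S] that by (simp add: compose_eq proper_frame_hom_def frame_hom_def)
  qed
  moreover have "way_below N (g (f a)) (g (f b))"
    if "a \<in> carrier L" "b \<in> carrier L" "way_below L a b" for a b
  proof -
    have "way_below M (f a) (f b)" using f that by (simp add: proper_frame_hom_def)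
    moreover have "f a \<in> carrier M" "f b \<in> carrier M" using that maps(1) by auto
    ultimately show ?thesis
      using g by (simp add: proper_frame_hom_def)
  qed
  ultimately show ?thesis by (simp add: proper_frame_hom_def compose_eq)
qed

lemma preimage_id: "U \<subseteq> points X \<Longrightarrow> preimage X (restrict id (points X)) U = U"
  by (auto simp: preimage_def)

lemma preimage_compose:
  "f \<in> points X \<rightarrow> points Y \<Longrightarrow> preimage X (compose (points X) g f) U = preimage X f (preimage Y g U)"
  by (auto simp: preimage_def compose_eq)

lemma continuous_map_restrict_id: "continuous_map T T (restrict id (topspace T))"
  by (rule continuous_map_eq[of T T id]) auto

lemma proper_L_morphism_id:
  assumes "priestley_space X"
  shows "proper_L_morphism X X (restrict id (points X))"
proof -
  interpret priestley X by unfold_locales (rule assms)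
  have "ker X U \<subseteq> points X" for U
    using ClopUpD(5) by (auto simp: ker_def)
  moreover have "W \<subseteq> points X" if "open_upset X W" for W
    using that openin_subset by (auto simp: open_upset_def)
  ultimately show ?thesis
    using continuous_map_restrict_id[of "topo X"] ord_points
    by (simp add: proper_L_morphism_def L_morphism_def preimage_id closure_of_subset_topspace ClopUpD(5))
qed

lemma proper_L_morphism_compose:
  assumes X: "priestley_space X" and Y: "priestley_space Y" and Z: "priestley_space Z"
    and f: "proper_L_morphism X Y f" and g: "proper_L_morphism Y Z g"
  shows "proper_L_morphism X Z (compose (points X) g f)"
proof -
  interpret priestley X by unfold_locales (rule X)
  have fg: "L_morphism X Y f" "L_morphism Y Z g" using f g by (simp_all add: proper_L_morphism_def)
  note pre = preimage_compose[OF L_morphism_funcset[OF fg(1)]]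
  have "L_morphism X Z (compose (points X) g f)"
    unfolding L_morphism_def
  proof (intro conjI allI impI)
    have "continuous_map (topo X) (topo Z) (g \<circ> f)"
      using fg continuous_map_compose by (auto simp: L_morphism_def)
    then show "continuous_map (topo X) (topo Z) (compose (points X) g f)"
      by (rule continuous_map_eq) (simp add: compose_eq)
    show "(compose (points X) g f x, compose (points X) g f y) \<in> ord Z" if "(x, y) \<in> ord X" for x y
      using that fg ord_points[OF that] by (simp add: compose_eq L_morphism_def)
    show "preimage X (compose (points X) g f) (cl Z W) = cl X (preimage X (compose (points X) g f) W)"
      if W: "open_upset Z W" for W
      using fg W preimage_open_upset[OF Y Z fg(2) W] by (simp add: pre L_morphism_def)
  qed
  moreover have "preimage X (compose (points X) g f) (ker Z U) \<subseteq> ker X (preimage X (compose (points X) g f) U)"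
    if U: "U \<in> ClopUp Z" for U
  proof -
    have "preimage Y g (ker Z U) \<subseteq> ker Y (preimage Y g U)"
      using g U by (simp add: proper_L_morphism_def)
    then have "preimage X f (preimage Y g (ker Z U)) \<subseteq> preimage X f (ker Y (preimage Y g U))"
      by (auto simp: preimage_def)
    also have "\<dots> \<subseteq> ker X (preimage X f (preimage Y g U))"
      using f preimage_ClopUp[OF Y Z fg(2) U] by (simp add: proper_L_morphism_def)
    finally show ?thesis by (simp add: pre)
  qed
  ultimately show ?thesis by (simp add: proper_L_morphism_def)
qed

lemma StKL_priestley: "StKL_space X \<Longrightarrow> priestley_space X"
  by (simp add: StKL_space_def StCL_space_def CL_space_def L_space_def esakia_space_def)

lemma stably_compact_is_frame: "stably_compact_frame L \<Longrightarrow> is_frame L"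
  by (simp add: stably_compact_frame_def compact_frame_def)

lemma StKFrm_is_category: "is_category (StKFrm \<U>)"
  unfolding StKFrm_def
proof (rule concrete_category_is_category)
  show "f \<in> carrier A \<rightarrow> carrier B" if "proper_frame_hom A B f" for A B :: "'a gorder" and f
    using that by (simp add: proper_frame_hom_def frame_hom_def)
qed (auto intro: proper_frame_hom_id proper_frame_hom_compose stably_compact_is_frame)

lemma StKLPries_is_category: "is_category (StKLPries \<U>)"
  unfolding StKLPries_def
proof (rule concrete_category_is_category)
  show "f \<in> points A \<rightarrow> points B" if "proper_L_morphism A B f" for A B :: "'a set ordered_space" and f
    using that L_morphism_funcset[of A B f] by (simp add: proper_L_morphism_def)
qed (auto intro: proper_L_morphism_id proper_L_morphism_compose StKL_priestley)

text \<open>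
  Any set of the right size carries a copy of the lattice of clopen upsets. The choice of \<open>A\<close> places
  the frame in the prescribed universe.
\<close>
lemma frame_representation_exists:
  fixes A :: "'b set"
  assumes "priestley_space X" "ClopUp X \<approx> A"
  shows "\<exists>L \<phi>. carrier L = A \<and> represents L \<phi> X"
proof -
  obtain \<phi> where \<phi>: "bij_betw \<phi> A (ClopUp X)"
    using assms(2) eqpoll_sym unfolding eqpoll_def by blast
  define L :: "'b gorder" where "L = \<lparr>carrier = A, eq = (=), le = (\<lambda>a b. \<phi> a \<subseteq> \<phi> b)\<rparr>"
  have "inj_on \<phi> A" using \<phi> by (simp add: bij_betw_def)
  then have "partial_order L"
    by unfold_locales (auto simp: L_def dest: inj_onD)
  then show ?thesis
    using assms(1) \<phi> by (intro exI[of _ L] exI[of _ \<phi>]) (simp add: represents_def L_def)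
qed

lemma represents_stably_compact_iff:
  "represents L \<phi> X \<Longrightarrow> stably_compact_frame L \<longleftrightarrow> StKL_space X"
  using representation.stably_compact_iff by (simp add: represents_iff)

lemma spectrum_representation:
  assumes "is_frame L"
  shows "\<exists>\<phi> (X :: 'a set ordered_space). represents (L :: 'a gorder) \<phi> X"
proof -
  interpret frame_lattice L
    using assms by (simp add: frame_lattice_def frame_lattice_axioms_def is_frame_complete)
  show ?thesis using represents_spectrum by blast
qed

lemma dual_maps_id: "represents L \<phi> X \<Longrightarrow> dual_maps L \<phi> \<phi> X (restrict id (carrier L)) (restrict id (points X))"
proof -
  assume "represents L \<phi> X"
  then interpret representation L X \<phi> by (simp add: represents_iff)
  show ?thesis
    using ClopUpD(5)[OF \<phi>_ClopUp] by (simp add: dual_maps_def preimage_id)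
qed

lemma dual_maps_compose:
  assumes "dual_maps L \<phi> \<psi> Y h f" "dual_maps M \<psi> \<chi> Z h' f'"
    and "h \<in> carrier L \<rightarrow> carrier M" "f' \<in> points Z \<rightarrow> points Y"
  shows "dual_maps L \<phi> \<chi> Z (compose (carrier L) h' h) (compose (points Z) f f')"
  using assms by (auto simp: dual_maps_def preimage_compose compose_eq)

lemma representation_pairI:
  assumes "represents L \<phi> X" "represents M \<psi> Y" "is_frame L" "is_frame M"
  shows "representation_pair L X \<phi> M Y \<psi>"
  using assms by (simp add: representation_pair_def frame_representation_def
      frame_representation_axioms_def represents_iff)

text \<open>
  The witnesses linking a frame to a space are the representations of the former on the latter. They
  reverse the direction of arrows, whence the opposite category. Both categories see the same universe
  because a representation is a bijection between the elements of the frame and the clopen upsets.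
\<close>
theorem corollary6p14:
  fixes \<U> :: "'a set set"
  shows "dually_equivalent (StKFrm \<U>) (StKLPries \<U>)"
proof -
  define C where "C = StKFrm \<U>"
  define D where "D = op_category (StKLPries \<U>)"
  define Rep where "Rep L \<phi> X \<longleftrightarrow> represents L \<phi> X \<and> L \<in> Obj C \<and> X \<in> Obj D"
    for L :: "'a gorder" and \<phi> and X :: "'a set ordered_space"
  define Cor where "Cor \<phi> \<psi> = (\<lambda>(L :: 'a gorder, h :: 'a \<Rightarrow> 'a, M :: 'a gorder)
      (Y :: 'a set ordered_space, f :: 'a set \<Rightarrow> 'a set, X :: 'a set ordered_space). dual_maps L \<phi> \<psi> Y h f)"
    for \<phi> \<psi> :: "'a \<Rightarrow> 'a set set"
  have Obj_C: "L \<in> Obj C \<longleftrightarrow> stably_compact_frame L \<and> carrier L \<in> \<U>" for L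
    by (simp add: C_def StKFrm_def concrete_category_def)
  have Obj_D: "X \<in> Obj D \<longleftrightarrow> StKL_space X \<and> (\<exists>A\<in>\<U>. ClopUp X \<approx> A)" for X
    by (simp add: D_def op_category_def StKLPries_def concrete_category_def)
  have arrows_C: "k \<in> arrows C L M \<longleftrightarrow> L \<in> Obj C \<and> M \<in> Obj C \<and>
      (\<exists>h. k = (L, h, M) \<and> h \<in> extensional (carrier L) \<and> proper_frame_hom L M h)" for k L M
    unfolding arrows_def C_def StKFrm_def concrete_category_def by auto
  have arrows_D: "k \<in> arrows D X Y \<longleftrightarrow> X \<in> Obj D \<and> Y \<in> Obj D \<and>
      (\<exists>f. k = (Y, f, X) \<and> f \<in> extensional (points Y) \<and> proper_L_morphism Y X f)" for k X Y
    unfolding arrows_def D_def op_category_def StKLPries_def concrete_category_def by auto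
  have pair: "representation_pair L X \<phi> M Y \<psi>" if "Rep L \<phi> X" "Rep M \<psi> Y" for L \<phi> X M \<psi> Y
    using that stably_compact_is_frame by (auto simp: Rep_def Obj_C intro: representation_pairI)
  have "correspondence C D Rep Cor"
  proof
    show "is_category C" "is_category D"
      unfolding C_def D_def
      by (simp_all add: StKFrm_is_category op_category_is_category StKLPries_is_category)
  next
    fix L \<phi> X assume "Rep L \<phi> X"
    then show "L \<in> Obj C \<and> X \<in> Obj D" by (simp add: Rep_def)
  next
    fix L assume L: "L \<in> Obj C"
    then obtain \<phi> and X :: "'a set ordered_space" where rep: "represents L \<phi> X"
      using spectrum_representation stably_compact_is_frame unfolding Obj_C by blast
    have "ClopUp X \<approx> carrier L"
      using rep eqpoll_sym unfolding represents_def eqpoll_def by blast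
    then have "X \<in> Obj D"
      using L represents_stably_compact_iff[OF rep] unfolding Obj_C Obj_D by blast
    then show "\<exists>\<phi> X. Rep L \<phi> X" using rep L unfolding Rep_def by blast
  next
    fix X assume X: "X \<in> Obj D"
    then obtain A where A: "A \<in> \<U>" "ClopUp X \<approx> A" unfolding Obj_D by blast
    obtain L \<phi> where rep: "carrier L = A" "represents L \<phi> X"
      using frame_representation_exists[OF StKL_priestley A(2)] X unfolding Obj_D by blast
    then have "L \<in> Obj C"
      using X A(1) represents_stably_compact_iff[OF rep(2)] unfolding Obj_C Obj_D by simp
    then show "\<exists>\<phi> L. Rep L \<phi> X" using rep(2) X unfolding Rep_def by blast
  next
    fix L \<phi> X M \<psi> Y k assume rep: "Rep L \<phi> X" "Rep M \<psi> Y" and k: "k \<in> arrows C L M"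
    interpret representation_pair L X \<phi> M Y \<psi> by (rule pair[OF rep])
    obtain h where h: "k = (L, h, M)" "proper_frame_hom L M h" using k unfolding arrows_C by blast
    obtain f where f: "f \<in> extensional (points Y)" "proper_L_morphism Y X f" "dual_maps L \<phi> \<psi> Y h f"
      and unique: "\<And>f'. \<lbrakk>f' \<in> extensional (points Y); proper_L_morphism Y X f'; dual_maps L \<phi> \<psi> Y h f'\<rbrakk> \<Longrightarrow> f' = f"
      using proper_dual_map[OF h(2)] by blast
    show "\<exists>!l. l \<in> arrows D X Y \<and> Cor \<phi> \<psi> k l"
    proof (rule ex1I[of _ "(Y, f, X)"])
      show "(Y, f, X) \<in> arrows D X Y \<and> Cor \<phi> \<psi> k (Y, f, X)"
        using f rep h(1) by (simp add: arrows_D Rep_def Cor_def)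
      show "l = (Y, f, X)" if "l \<in> arrows D X Y \<and> Cor \<phi> \<psi> k l" for l
        using that unique h(1) by (auto simp: arrows_D Cor_def)
    qed
  next
    fix L \<phi> X M \<psi> Y l assume rep: "Rep L \<phi> X" "Rep M \<psi> Y" and l: "l \<in> arrows D X Y"
    interpret representation_pair L X \<phi> M Y \<psi> by (rule pair[OF rep])
    obtain f where f: "l = (Y, f, X)" "proper_L_morphism Y X f" using l unfolding arrows_D by blast
    obtain h where h: "h \<in> extensional (carrier L)" "proper_frame_hom L M h" "dual_maps L \<phi> \<psi> Y h f"
      and unique: "\<And>h'. \<lbrakk>h' \<in> extensional (carrier L); proper_frame_hom L M h'; dual_maps L \<phi> \<psi> Y h' f\<rbrakk> \<Longrightarrow> h' = h"
      using proper_dual_hom[OF f(2)] by blast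
    show "\<exists>!k. k \<in> arrows C L M \<and> Cor \<phi> \<psi> k l"
    proof (rule ex1I[of _ "(L, h, M)"])
      show "(L, h, M) \<in> arrows C L M \<and> Cor \<phi> \<psi> (L, h, M) l"
        using h rep f(1) by (simp add: arrows_C Rep_def Cor_def)
      show "k = (L, h, M)" if "k \<in> arrows C L M \<and> Cor \<phi> \<psi> k l" for k
        using that unique f(1) by (auto simp: arrows_C Cor_def)
    qed
  next
    fix L \<phi> X assume "Rep L \<phi> X"
    then show "Cor \<phi> \<phi> (Ident C L) (Ident D X)"
      using dual_maps_id[of L \<phi> X] by (simp add: Rep_def Cor_def C_def D_def StKFrm_def op_category_def
          StKLPries_def concrete_category_def)
  next
    fix L \<phi> X M \<psi> Y N \<chi> Z k k' l l'
    assume *: "k \<in> arrows C L M" "k' \<in> arrows C M N" "l \<in> arrows D X Y" "l' \<in> arrows D Y Z"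
      "Cor \<phi> \<psi> k l" "Cor \<psi> \<chi> k' l'"
    obtain h h' f f' where k: "k = (L, h, M)" "k' = (M, h', N)" "proper_frame_hom L M h"
      and l: "l = (Y, f, X)" "l' = (Z, f', Y)" "proper_L_morphism Z Y f'"
      using *(1-4) unfolding arrows_C arrows_D by blast
    have "h \<in> carrier L \<rightarrow> carrier M" "f' \<in> points Z \<rightarrow> points Y"
      using k(3) l(3) L_morphism_funcset
      by (auto simp: proper_frame_hom_def frame_hom_def proper_L_morphism_def)
    then show "Cor \<phi> \<chi> (Comp C k' k) (Comp D l' l)"
      using *(5,6) k l dual_maps_compose
      by (simp add: Cor_def C_def D_def StKFrm_def op_category_def StKLPries_def concrete_category_def)
  qed
  then show ?thesis
    unfolding dually_equivalent_def C_def D_def by (rule correspondence.equivalent)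
qed

end
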